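(* Let $\{X_t,t\ge 0\}$ be an irreducible, positive recurrent, time-homogeneous continuous-time Markov chain on a countable state space $E$, with totally stable and regular $Q$-matrix $Q=(Q(i,j))_{i,j\in E}$ and unique invariant probability distribution $\pi$. Assume that $X_t$ admits an $\mathcal{L}^2(\pi)$-spectral gap $\lambda(Q)$ (that is, $\lambda(Q)>0$), and that the symmetrized $Q$-matrix $\bar Q$ is regular. Then for any real numbers $a<b$, any function $g:E\to[a,b]$, and any $t,\varepsilon>0$, $$\mathbb{P}_{\pi}\left(\frac{1}{t}\int_0^t g(X_s)\,\mathrm{d}s-\pi(g)\ge\varepsilon\right)\le\exp\left\{-\frac{\lambda(Q)\,t\,\varepsilon^2}{(b-a)^2}\right\}.$$
   Context: A $Q$-matrix is totally stable if $-Q(i,i)<\infty$ for all $i\in E$; it is regular if it is conservative ($\sum_{j}Q(i,j)=0$ for all $i$) and the associated minimal process is non-explosive, so that the $Q$-process is unique. The chain $X_t$ is the $Q$-process, with right-continuous sample paths with left limits, and $P_t=(P_t(i,j))_{i,j\in E}$ is its transition function. $\mathbb{P}_\pi$ is the law of the chain with initial distribution $\pi$, and $\pi(f)=\sum_{i\in E}\pi(i)f(i)$. $\mathcal{L}^2(\pi)=\{f:\pi(f^2)<\infty\}$ (real functions on $E$), with $\langle f,h\rangle_\pi=\sum_{i\in E}\pi(i)f(i)h(i)$ and $\|f\|_{\pi,2}=\langle f,f\rangle_\pi^{1/2}$. $P_t$ acts on $\mathcal{L}^2(\pi)$ as a strongly continuous contraction semigroup, $P_tf(i)=\sum_jP_t(i,j)f(j)$.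 Its infinitesimal generator $\mathcal{A}$ is $\mathcal{A}f=\lim_{t\to0^+}(P_tf-f)/t$ (limit in $\mathcal{L}^2(\pi)$), with domain $\mathcal{D}(\mathcal{A})$ the set of $f\in\mathcal{L}^2(\pi)$ for which the limit exists in $\mathcal{L}^2(\pi)$. Set $$\lambda(Q):=\inf\{-\langle\mathcal{A}f,f\rangle_\pi: f\in\mathcal{D}(\mathcal{A}),\ \|f\|_{\pi,2}=1,\ \pi(f)=0\};$$ the chain is said to admit an $\mathcal{L}^2(\pi)$-spectral gap $\lambda(Q)$ if $\lambda(Q)>0$. The dual $Q$-matrix is $\hat Q(i,j)=\pi(j)Q(j,i)/\pi(i)$ and the symmetrized $Q$-matrix is $\bar Q(i,j)=\frac{1}{2}\left(Q(i,j)+\hat Q(i,j)\right)$, $i,j\in E$. *)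

theory Defs
  imports "HOL-Probability.Probability"
begin

section \<open>Q-matrices and the minimal process\<close>

text \<open>
  Entries are real numbers, so every Q-matrix below is totally stable
  (\<open>- Q i i < \<infinity>\<close> for all \<open>i\<close>).
\<close>

definition q_matrix :: "('e \<Rightarrow> 'e \<Rightarrow> real) \<Rightarrow> bool" where
  "q_matrix Q \<longleftrightarrow>
     (\<forall>i j. i \<noteq> j \<longrightarrow> 0 \<le> Q i j) \<and>
     (\<forall>i. Q i summable_on UNIV \<and> (\<Sum>\<^sub>\<infinity>j. Q i j) \<le> 0)"

definition conservative :: "('e \<Rightarrow> 'e \<Rightarrow> real) \<Rightarrow> bool" where
  "conservative Q \<longleftrightarrow> (\<forall>i. (Q i has_sum 0) UNIV)"

text \<open>
  Feller's construction of the minimal process from the integrated backward equation: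
  \<open>feller_iter Q n t i j\<close> is the probability that the minimal process started in \<open>i\<close>
  is in \<open>j\<close> at time \<open>t\<close> and has made fewer than \<open>n\<close> jumps up to time \<open>t\<close>. The summand for
  \<open>k\<close> is the contribution of a first jump at time \<open>s\<close> from \<open>i\<close> to \<open>k\<close>.
\<close>

primrec feller_iter ::
    "('e \<Rightarrow> 'e \<Rightarrow> real) \<Rightarrow> nat \<Rightarrow> real \<Rightarrow> 'e \<Rightarrow> 'e \<Rightarrow> ennreal" where
  "feller_iter Q 0 = (\<lambda>t i j. 0)"
| "feller_iter Q (Suc n) = (\<lambda>t i j.
     (if i = j then ennreal (exp (Q i i * t)) else 0) +
     (\<integral>\<^sup>+ s\<in>{0..t}. (\<integral>\<^sup>+ k. ennreal (exp (Q i i * s) * Q i k) * feller_iter Q n (t - s) k j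
        \<partial>count_space (- {i})) \<partial>lborel))"

definition minimal_process :: "('e \<Rightarrow> 'e \<Rightarrow> real) \<Rightarrow> real \<Rightarrow> 'e \<Rightarrow> 'e \<Rightarrow> ennreal" where
  "minimal_process Q t i j = (SUP n. feller_iter Q n t i j)"

text \<open>The minimal process has not exploded by time \<open>t\<close> iff it is in some state at time \<open>t\<close>.\<close>

definition non_explosive :: "('e \<Rightarrow> 'e \<Rightarrow> real) \<Rightarrow> bool" where
  "non_explosive Q \<longleftrightarrow>
     (\<forall>t\<ge>0. \<forall>i. (\<integral>\<^sup>+ j. minimal_process Q t i j \<partial>count_space UNIV) = 1)"

definition regular_q :: "('e \<Rightarrow> 'e \<Rightarrow> real) \<Rightarrow> bool" where
  "regular_q Q \<longleftrightarrow> q_matrix Q \<and> conservative Q \<and> non_explosive Q"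

definition dual_q :: "'e pmf \<Rightarrow> ('e \<Rightarrow> 'e \<Rightarrow> real) \<Rightarrow> 'e \<Rightarrow> 'e \<Rightarrow> real" where
  "dual_q \<pi> Q i j = pmf \<pi> j * Q j i / pmf \<pi> i"

definition symmetrized_q :: "'e pmf \<Rightarrow> ('e \<Rightarrow> 'e \<Rightarrow> real) \<Rightarrow> 'e \<Rightarrow> 'e \<Rightarrow> real" where
  "symmetrized_q \<pi> Q i j = (Q i j + dual_q \<pi> Q i j) / 2"


section \<open>The Q-process\<close>

text \<open>
  A transition function is represented by \<open>P\<close> with \<open>pmf (P t i) j\<close> for \<open>P\<^sub>t(i,j)\<close>, \<open>t \<ge> 0\<close>.
  Using \<open>pmf\<close> makes it honest (row sums 1), as the transition function of a regular
  Q-matrix is; the limit at 0 also contains \<open>P\<^sub>t(i,j) \<rightarrow> \<delta>\<^sub>i\<^sub>j\<close>.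
\<close>

definition q_transition :: "('e \<Rightarrow> 'e \<Rightarrow> real) \<Rightarrow> (real \<Rightarrow> 'e \<Rightarrow> 'e pmf) \<Rightarrow> bool" where
  "q_transition Q P \<longleftrightarrow>
     (\<forall>i. P 0 i = return_pmf i) \<and>
     (\<forall>s\<ge>0. \<forall>t\<ge>0. \<forall>i. P (s + t) i = bind_pmf (P s i) (P t)) \<and>
     (\<forall>i j. ((\<lambda>t. (pmf (P t i) j - of_bool (i = j)) / t) \<longlongrightarrow> Q i j) (at_right 0))"

text \<open>
  Right-continuity with left limits is with respect to the discrete topology of the state space,
  where a limit means being eventually equal to it.
\<close>

definition cadlag_path :: "(real \<Rightarrow> 'e) \<Rightarrow> bool" where
  "cadlag_path x \<longleftrightarrow>
     (\<forall>t\<ge>0. eventually (\<lambda>s. x s = x t) (at_right t)) \<and>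
     (\<forall>t>0. \<exists>i. eventually (\<lambda>s. x s = i) (at_left t))"

definition markov_chain ::
    "'w measure \<Rightarrow> (real \<Rightarrow> 'w \<Rightarrow> 'e) \<Rightarrow> 'e pmf \<Rightarrow> (real \<Rightarrow> 'e \<Rightarrow> 'e pmf) \<Rightarrow> bool" where
  "markov_chain M X \<mu> P \<longleftrightarrow>
     prob_space M \<and>
     (\<forall>t\<ge>0. X t \<in> measurable M (count_space UNIV)) \<and>
     (\<forall>n (t :: nat \<Rightarrow> real) (i :: nat \<Rightarrow> 'e). t 0 = 0 \<and> (\<forall>k<n. t k < t (Suc k)) \<longrightarrow>
        measure M {\<omega> \<in> space M. \<forall>k\<le>n. X (t k) \<omega> = i k} =
        pmf \<mu> (i 0) * (\<Prod>k<n. pmf (P (t (Suc k) - t k) (i k)) (i (Suc k)))) \<and>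
     (\<forall>\<omega>\<in>space M. cadlag_path (\<lambda>t. X t \<omega>))"

definition irreducible_chain :: "(real \<Rightarrow> 'e \<Rightarrow> 'e pmf) \<Rightarrow> bool" where
  "irreducible_chain P \<longleftrightarrow> (\<forall>i j. \<exists>t>0. 0 < pmf (P t i) j)"

definition invariant_distr :: "(real \<Rightarrow> 'e \<Rightarrow> 'e pmf) \<Rightarrow> 'e pmf \<Rightarrow> bool" where
  "invariant_distr P \<pi> \<longleftrightarrow> (\<forall>t\<ge>0. bind_pmf \<pi> (P t) = \<pi>)"

text \<open>Both times are \<open>\<infinity>\<close> (the infimum of the empty set) if the event never happens.\<close>

definition first_jump_time :: "(real \<Rightarrow> 'w \<Rightarrow> 'e) \<Rightarrow> 'w \<Rightarrow> ennreal" where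
  "first_jump_time X \<omega> = (INF t\<in>{t. 0 \<le> t \<and> X t \<omega> \<noteq> X 0 \<omega>}. ennreal t)"

definition return_time :: "(real \<Rightarrow> 'w \<Rightarrow> 'e) \<Rightarrow> 'e \<Rightarrow> 'w \<Rightarrow> ennreal" where
  "return_time X i \<omega> =
     (INF t\<in>{t. 0 \<le> t \<and> first_jump_time X \<omega> \<le> ennreal t \<and> X t \<omega> = i}. ennreal t)"

text \<open>
  \<open>PP \<mu>\<close> is the law of the chain with initial distribution \<open>\<mu>\<close>. As usual an absorbing state,
  which is never left and hence has no return time, counts as positive recurrent.
\<close>

definition positive_recurrent ::
    "('e \<Rightarrow> 'e \<Rightarrow> real) \<Rightarrow> ('e pmf \<Rightarrow> 'w measure) \<Rightarrow> (real \<Rightarrow> 'w \<Rightarrow> 'e) \<Rightarrow> bool" where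
  "positive_recurrent Q PP X \<longleftrightarrow>
     (\<forall>i. Q i i = 0 \<or> (\<integral>\<^sup>+ \<omega>. return_time X i \<omega> \<partial>PP (return_pmf i)) < \<infinity>)"


section \<open>The generator on \<open>L\<^sup>2(\<pi>)\<close> and the spectral gap\<close>

definition L2 :: "'e pmf \<Rightarrow> ('e \<Rightarrow> real) set" where
  "L2 \<pi> = {f. integrable (measure_pmf \<pi>) (\<lambda>i. (f i)\<^sup>2)}"

definition inner_L2 :: "'e pmf \<Rightarrow> ('e \<Rightarrow> real) \<Rightarrow> ('e \<Rightarrow> real) \<Rightarrow> real" where
  "inner_L2 \<pi> f h = measure_pmf.expectation \<pi> (\<lambda>i. f i * h i)"

definition norm_L2 :: "'e pmf \<Rightarrow> ('e \<Rightarrow> real) \<Rightarrow> real" where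
  "norm_L2 \<pi> f = sqrt (inner_L2 \<pi> f f)"

definition semigroup_op :: "(real \<Rightarrow> 'e \<Rightarrow> 'e pmf) \<Rightarrow> real \<Rightarrow> ('e \<Rightarrow> real) \<Rightarrow> 'e \<Rightarrow> real" where
  "semigroup_op P t f i = measure_pmf.expectation (P t i) f"

definition generator_limit ::
    "'e pmf \<Rightarrow> (real \<Rightarrow> 'e \<Rightarrow> 'e pmf) \<Rightarrow> ('e \<Rightarrow> real) \<Rightarrow> ('e \<Rightarrow> real) \<Rightarrow> bool" where
  "generator_limit \<pi> P f h \<longleftrightarrow>
     h \<in> L2 \<pi> \<and>
     ((\<lambda>t. norm_L2 \<pi> (\<lambda>i. (semigroup_op P t f i - f i) / t - h i)) \<longlongrightarrow> 0) (at_right 0)"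

definition generator_domain :: "'e pmf \<Rightarrow> (real \<Rightarrow> 'e \<Rightarrow> 'e pmf) \<Rightarrow> ('e \<Rightarrow> real) set" where
  "generator_domain \<pi> P = {f \<in> L2 \<pi>. \<exists>h. generator_limit \<pi> P f h}"

text \<open>The limit is a unique function because \<open>\<pi>\<close> charges every state of an irreducible chain.\<close>

definition generator ::
    "'e pmf \<Rightarrow> (real \<Rightarrow> 'e \<Rightarrow> 'e pmf) \<Rightarrow> ('e \<Rightarrow> real) \<Rightarrow> 'e \<Rightarrow> real" where
  "generator \<pi> P f = (THE h. generator_limit \<pi> P f h)"

text \<open>
  Extended real, so that the infimum is \<open>\<infinity>\<close> when there is no admissible \<open>f\<close>, which happens for
  a one-point state space.
\<close>

definition spectral_gap :: "'e pmf \<Rightarrow> (real \<Rightarrow> 'e \<Rightarrow> 'e pmf) \<Rightarrow> ereal" where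
  "spectral_gap \<pi> P =
     (INF f\<in>{f \<in> generator_domain \<pi> P. norm_L2 \<pi> f = 1 \<and> measure_pmf.expectation \<pi> f = 0}.
        ereal (- inner_L2 \<pi> (generator \<pi> P f) f))"

definition ereal_exp :: "ereal \<Rightarrow> ereal" where
  "ereal_exp x =
     (if x = \<infinity> then \<infinity> else if x = -\<infinity> then 0 else ereal (exp (real_of_ereal x)))"

end

theory Submission
  imports Defs
begin

text \<open>
  The proof bounds the moment generating function of a time integral by a discretisation, and reads
  all that it needs about the chain off the decay of its semigroup on mean-zero functions.

  \<^item> \<^emph>\<open>Decay.\<close> Along the semigroup, the derivative of \<open>\<parallel>P\<^sub>t f\<parallel>\<^sup>2\<close> is \<open>2 \<langle>A P\<^sub>t f, P\<^sub>t f\<rangle>\<close>, so that for a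
  spectral gap at least \<open>\<gamma>\<close> one has \<open>\<parallel>P\<^sub>t f\<parallel> \<le> exp (- \<gamma> t) \<parallel>f\<parallel>\<close> whenever \<open>\<pi>(f) = 0\<close>
  (lemma \<open>spectral_decay\<close>). Bounded functions suffice: the averages \<open>r\<inverse> \<integral>\<^sub>0\<^sup>r P\<^sub>s f ds\<close> of a bounded \<open>f\<close>
  are bounded, lie in the domain of the generator, have a bounded image under it, and converge
  to \<open>f\<close>. Hence every limit in \<open>L\<^sup>2(\<pi>)\<close> is an instance of bounded convergence.

  \<^item> \<^emph>\<open>One tilted step.\<close> Let \<open>f = g - \<pi>(g)\<close>, which has oscillation at most \<open>D = b - a\<close>. For every
  bounded \<open>w\<close>, \<open>\<pi>(f w\<^sup>2) \<le> D \<parallel>w\<parallel> sqrt (Var w)\<close> (lemma \<open>expectation_times_square_le\<close>); this is the bound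
  of a difference of expectations by the total variation distance, which in turn is bounded in terms of
  the Hellinger affinity. Therefore \<open>\<theta> \<pi>(f w\<^sup>2) - \<gamma> Var w \<le> \<theta>\<^sup>2 D\<^sup>2 / (4 \<gamma>) \<parallel>w\<parallel>\<^sup>2\<close>. The decay over a short time
  \<open>\<delta>\<close> pays for the term \<open>\<gamma> Var w\<close>, so that the operator \<open>h \<mapsto> exp (\<delta> \<theta> f) P\<^sub>\<delta> h\<close> has norm
  at most \<open>exp (\<delta> \<theta>\<^sup>2 D\<^sup>2 / (4 \<gamma>) + O(\<delta>\<^sup>2))\<close> (lemma \<open>tilted_step_le\<close>).

  \<^item> \<^emph>\<open>Passage to the limit.\<close> Under the stationary law, \<open>exp (\<theta> \<delta> \<Sum>\<^sub>k f(X\<^bsub>k\<delta>\<^esub>))\<close> has expectation \<open>\<pi>(F)\<close>, where \<open>F\<close>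
  comes from iterating the tilted operator. With \<open>\<delta> = t / n\<close> the Riemann sums
  converge along every right-continuous path, and so the exponential moment of \<open>\<integral>\<^sub>0\<^sup>t f(X\<^sub>s) ds\<close> is at most
  \<open>exp (t \<theta>\<^sup>2 D\<^sup>2 / (4 \<gamma>))\<close>. The Chernoff bound with the optimal \<open>\<theta> = 2 \<gamma> \<epsilon> / D\<^sup>2\<close> is the claim
  (theorem \<open>hoeffding_time_integral\<close>).

  The spectral gap is an extended real number. The bound is proved for every real \<open>\<gamma> > 0\<close> that does not exceed it;
  an infinite gap then forces the probability to be zero.
\<close>

section \<open>Bounded functions under probability mass functions\<close>

lemma bounded_mult_real:
  fixes f h :: "'a \<Rightarrow> real"
  assumes "bounded (f ` S)" "bounded (h ` S)"
  shows "bounded ((\<lambda>x. f x * h x) ` S)"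
proof -
  obtain A B where A: "\<And>x. x \<in> S \<Longrightarrow> \<bar>f x\<bar> \<le> A" and B: "\<And>x. x \<in> S \<Longrightarrow> \<bar>h x\<bar> \<le> B"
    using assms by (auto simp: bounded_iff)
  have "\<bar>f x * h x\<bar> \<le> A * B" if "x \<in> S" for x
    unfolding abs_mult using A[OF that] B[OF that] by (intro mult_mono) auto
  then show ?thesis
    by (auto simp: bounded_iff)
qed

lemma bounded_const_fun: "bounded ((\<lambda>x. c :: real) ` S)"
  by (auto simp: bounded_iff)

lemma bounded_divide_real:
  fixes f :: "'a \<Rightarrow> real"
  shows "bounded (f ` S) \<Longrightarrow> bounded ((\<lambda>x. f x / c) ` S)"
  using bounded_mult_real[OF _ bounded_const_fun, of f S "1/c"] by simp

lemma bounded_power2_real: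
  fixes f :: "'a \<Rightarrow> real"
  shows "bounded (f ` S) \<Longrightarrow> bounded ((\<lambda>x. (f x)\<^sup>2) ` S)"
  using bounded_mult_real[of f S f] by (simp add: power2_eq_square)

lemma bounded_abs_real:
  fixes f :: "'a \<Rightarrow> real"
  shows "bounded (f ` S) \<Longrightarrow> bounded ((\<lambda>x. \<bar>f x\<bar>) ` S)"
  by (auto simp: bounded_iff)

lemmas bounded_fun_intros = bounded_const_fun bounded_plus_comp bounded_minus_comp
  bounded_mult_real bounded_divide_real bounded_power2_real bounded_abs_real

lemma integrable_pmf_bounded:
  fixes f :: "'a \<Rightarrow> real"
  assumes "bounded (range f)"
  shows "integrable (measure_pmf p) f"
proof -
  obtain B where "\<And>x. \<bar>f x\<bar> \<le> B"
    using assms by (auto simp: bounded_iff)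
  then show ?thesis
    by (intro measure_pmf.integrable_const_bound[where B = B]) auto
qed

lemmas integrable_pmf_intros = integrable_pmf_bounded bounded_fun_intros

lemma integral_bind_pmf_bounded:
  fixes f :: "'b \<Rightarrow> real"
  assumes "bounded (range f)"
  shows "measure_pmf.expectation (bind_pmf p q) f =
         measure_pmf.expectation p (\<lambda>x. measure_pmf.expectation (q x) f)"
proof -
  obtain B where B: "\<And>x. \<bar>f x\<bar> \<le> B"
    using assms by (auto simp: bounded_iff)
  show ?thesis
    unfolding measure_pmf_bind
  proof (rule integral_bind[where K = "count_space UNIV" and B' = 1 and B = B])
    show "(\<lambda>x. measure_pmf (q x)) \<in> measurable (measure_pmf p) (subprob_algebra (count_space UNIV))"
      using measurable_measure_pmf[of q] by simp
    show "AE x in measure_pmf p. emeasure (measure_pmf (q x)) (space (measure_pmf (q x))) \<le> ennreal 1"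
      by (simp add: measure_pmf.emeasure_space_1)
  qed (use B measure_pmf.finite_measure_axioms in auto)
qed

lemma abs_expectation_pmf_le:
  fixes f :: "'a \<Rightarrow> real"
  assumes "\<And>x. \<bar>f x\<bar> \<le> B"
  shows "\<bar>measure_pmf.expectation p f\<bar> \<le> B"
proof -
  have "\<bar>measure_pmf.expectation p f\<bar> \<le> measure_pmf.expectation p (\<lambda>x. \<bar>f x\<bar>)"
    using integral_norm_bound[of "measure_pmf p" f] by simp
  also have "\<dots> \<le> B"
    using assms by (intro measure_pmf.integral_le_const integrable_pmf_intros)
      (auto simp: bounded_iff)
  finally show ?thesis .
qed

lemma expectation_pmf_square_le:
  fixes f :: "'a \<Rightarrow> real"
  assumes "bounded (range f)"
  shows "(measure_pmf.expectation p f)\<^sup>2 \<le> measure_pmf.expectation p (\<lambda>x. (f x)\<^sup>2)"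
proof -
  have "0 \<le> measure_pmf.variance p f"
    by simp
  then show ?thesis
    using assms by (subst (asm) measure_pmf.variance_eq) (auto intro!: integrable_pmf_intros)
qed

lemma expectation_pmf_Cauchy_Schwarz:
  fixes f h :: "'a \<Rightarrow> real"
  assumes "bounded (range f)" "bounded (range h)"
  shows "\<bar>measure_pmf.expectation p (\<lambda>x. f x * h x)\<bar>
    \<le> sqrt (measure_pmf.expectation p (\<lambda>x. (f x)\<^sup>2)) * sqrt (measure_pmf.expectation p (\<lambda>x. (h x)\<^sup>2))"
proof -
  have *: "(\<integral>\<^sup>+x. ennreal (u x) \<partial>measure_pmf p) = ennreal (measure_pmf.expectation p u)"
    if "bounded (range u)" "\<And>x. 0 \<le> u x" for u
    using that by (intro nn_integral_eq_integral integrable_pmf_bounded) auto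
  have sq: "(\<integral>\<^sup>+x. (ennreal \<bar>u x\<bar>)\<^sup>2 \<partial>measure_pmf p)
      = ennreal (measure_pmf.expectation p (\<lambda>x. (u x)\<^sup>2))" if "bounded (range u)" for u
    using *[of "\<lambda>x. (u x)\<^sup>2"] that by (simp add: ennreal_power bounded_fun_intros)
  have pr: "(\<integral>\<^sup>+x. ennreal \<bar>f x\<bar> * ennreal \<bar>h x\<bar> \<partial>measure_pmf p)
      = ennreal (measure_pmf.expectation p (\<lambda>x. \<bar>f x\<bar> * \<bar>h x\<bar>))"
    using *[of "\<lambda>x. \<bar>f x\<bar> * \<bar>h x\<bar>"] assms by (simp add: ennreal_mult bounded_fun_intros)
  have "ennreal ((measure_pmf.expectation p (\<lambda>x. \<bar>f x\<bar> * \<bar>h x\<bar>))\<^sup>2)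
      \<le> ennreal (measure_pmf.expectation p (\<lambda>x. (f x)\<^sup>2) * measure_pmf.expectation p (\<lambda>x. (h x)\<^sup>2))"
    using Cauchy_Schwarz_nn_integral[of "\<lambda>x. ennreal \<bar>f x\<bar>" "measure_pmf p" "\<lambda>x. ennreal \<bar>h x\<bar>"]
    unfolding pr sq[OF assms(1)] sq[OF assms(2)]
    by (simp add: ennreal_power ennreal_mult)
  then have "(measure_pmf.expectation p (\<lambda>x. \<bar>f x\<bar> * \<bar>h x\<bar>))\<^sup>2
      \<le> measure_pmf.expectation p (\<lambda>x. (f x)\<^sup>2) * measure_pmf.expectation p (\<lambda>x. (h x)\<^sup>2)"
    by (subst (asm) ennreal_le_iff) auto
  then have "\<bar>measure_pmf.expectation p (\<lambda>x. \<bar>f x\<bar> * \<bar>h x\<bar>)\<bar>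
    \<le> sqrt (measure_pmf.expectation p (\<lambda>x. (f x)\<^sup>2)) * sqrt (measure_pmf.expectation p (\<lambda>x. (h x)\<^sup>2))"
    by (metis real_sqrt_abs real_sqrt_le_iff real_sqrt_mult)
  moreover have "\<bar>measure_pmf.expectation p (\<lambda>x. f x * h x)\<bar>
      \<le> measure_pmf.expectation p (\<lambda>x. \<bar>f x\<bar> * \<bar>h x\<bar>)"
    using integral_norm_bound[of "measure_pmf p" "\<lambda>x. f x * h x"] by (simp add: abs_mult)
  ultimately show ?thesis
    by linarith
qed

lemma expectation_pmf_tendsto:
  fixes u :: "real \<Rightarrow> 'a \<Rightarrow> real"
  assumes "\<And>t x. t > 0 \<Longrightarrow> \<bar>u t x\<bar> \<le> B"
    and "\<And>x. ((\<lambda>t. u t x) \<longlongrightarrow> v x) (at_right 0)"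
  shows "((\<lambda>t. measure_pmf.expectation p (u t)) \<longlongrightarrow> measure_pmf.expectation p v) (at_right 0)"
proof (rule tendsto_at_right_sequentially[of 0 1])
  fix S :: "nat \<Rightarrow> real" assume S: "\<And>n. 0 < S n" "S \<longlonglongrightarrow> 0"
  have "\<forall>\<^sub>F n in sequentially. S n \<in> {0<..} \<and> S n \<noteq> 0"
    using S(1) by (intro always_eventually) (auto simp: less_imp_neq[symmetric])
  then have "filterlim S (at_right 0) sequentially"
    using S(2) by (auto simp: filterlim_at)
  then have "(\<lambda>n. u (S n) x) \<longlonglongrightarrow> v x" for x
    using assms(2) filterlim_compose by blast
  then show "(\<lambda>n. measure_pmf.expectation p (u (S n))) \<longlonglongrightarrow> measure_pmf.expectation p v"
    using assms(1) S(1) by (intro integral_dominated_convergence[where w = "\<lambda>_. B"]) auto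
qed simp

section \<open>Markov semigroups with an invariant distribution\<close>

text \<open>
  Two of the conditions link pointwise statements with statements in \<open>L\<^sup>2(\<pi>)\<close>: the transition function is standard, so
  that bounded convergence applies as \<open>t \<rightarrow> 0\<close>, and \<open>\<pi>\<close> charges every state, so that a function
  is determined by its class in \<open>L\<^sup>2(\<pi>)\<close>.
\<close>

locale stationary_semigroup =
  fixes P :: "real \<Rightarrow> 'e::countable \<Rightarrow> 'e pmf" and \<pi> :: "'e pmf"
  assumes P_0: "P 0 i = return_pmf i"
    and P_add: "0 \<le> s \<Longrightarrow> 0 \<le> t \<Longrightarrow> P (s + t) i = bind_pmf (P s i) (P t)"
    and P_standard: "((\<lambda>t. pmf (P t i) i) \<longlongrightarrow> 1) (at_right 0)"
    and invariant: "0 \<le> t \<Longrightarrow> bind_pmf \<pi> (P t) = \<pi>"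
    and full_support: "0 < pmf \<pi> i"
begin

abbreviation S :: "real \<Rightarrow> ('e \<Rightarrow> real) \<Rightarrow> 'e \<Rightarrow> real" where
  "S \<equiv> semigroup_op P"

abbreviation E :: "('e \<Rightarrow> real) \<Rightarrow> real" where
  "E \<equiv> measure_pmf.expectation \<pi>"

lemma abs_S_le: "(\<And>i. \<bar>f i\<bar> \<le> B) \<Longrightarrow> \<bar>S t f i\<bar> \<le> B"
  unfolding semigroup_op_def by (rule abs_expectation_pmf_le)

lemma bounded_S: "bounded (range (S t f))" if bd: "bounded (range f)"
proof -
  from bd obtain B where "\<And>i. \<bar>f i\<bar> \<le> B"
    by (auto simp: bounded_iff)
  then have "\<And>i. \<bar>S t f i\<bar> \<le> B"
    by (rule abs_S_le)
  then show ?thesis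
    by (auto simp: bounded_iff)
qed

lemmas bfun = bounded_fun_intros bounded_S

lemma S_const [simp]: "S t (\<lambda>_. c) = (\<lambda>_. c)"
  by (simp add: semigroup_op_def fun_eq_iff)

lemma S_add: "bounded (range f) \<Longrightarrow> bounded (range h) \<Longrightarrow> S t (\<lambda>i. f i + h i) = (\<lambda>i. S t f i + S t h i)"
  by (simp add: semigroup_op_def fun_eq_iff integrable_pmf_bounded)

lemma S_diff: "bounded (range f) \<Longrightarrow> bounded (range h) \<Longrightarrow> S t (\<lambda>i. f i - h i) = (\<lambda>i. S t f i - S t h i)"
  by (simp add: semigroup_op_def fun_eq_iff integrable_pmf_bounded)

lemma S_divide: "S t (\<lambda>i. f i / c) = (\<lambda>i. S t f i / c)"
  by (simp add: semigroup_op_def fun_eq_iff)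

lemma S_mult: "S t (\<lambda>i. c * f i) = (\<lambda>i. c * S t f i)"
  by (simp add: semigroup_op_def fun_eq_iff)

lemma S_0 [simp]: "S 0 f = f"
  by (simp add: semigroup_op_def fun_eq_iff P_0)

lemma S_S:
  assumes "0 \<le> s" "0 \<le> t" "bounded (range f)"
  shows "S s (S t f) = S (s + t) f"
proof
  show "S s (S t f) i = S (s + t) f i" for i
    using integral_bind_pmf_bounded[OF assms(3), of "P s i" "P t"]
    unfolding semigroup_op_def P_add[OF assms(1,2)] by simp
qed

lemma E_S:
  assumes "0 \<le> t" "bounded (range f)"
  shows "E (S t f) = E f"
  using integral_bind_pmf_bounded[OF assms(2), of \<pi> "P t"] invariant[OF assms(1)]
  unfolding semigroup_op_def by simp

lemma E_S_square_le:
  assumes "0 \<le> t" "bounded (range f)"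
  shows "E (\<lambda>i. (S t f i)\<^sup>2) \<le> E (\<lambda>i. (f i)\<^sup>2)"
proof -
  have "(S t f i)\<^sup>2 \<le> S t (\<lambda>i. (f i)\<^sup>2) i" for i
    using expectation_pmf_square_le[OF assms(2)] by (simp add: semigroup_op_def)
  then have "E (\<lambda>i. (S t f i)\<^sup>2) \<le> E (S t (\<lambda>i. (f i)\<^sup>2))"
    by (intro integral_mono integrable_pmf_bounded bfun assms) auto
  then show ?thesis
    using assms by (simp add: E_S bfun)
qed

text \<open>
  The difference is the expectation of \<open>f j - f i\<close>, which vanishes on the event that the chain is
  at \<open>i\<close> again. The bound depends on \<open>f\<close> only through its supremum.
\<close>

lemma abs_S_minus_le:
  assumes "\<And>i. \<bar>f i\<bar> \<le> B"
  shows "\<bar>S t f i - f i\<bar> \<le> 2 * B * (1 - pmf (P t i) i)"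
proof -
  have bf: "bounded (range f)"
    using assms by (auto simp: bounded_iff)
  have bi: "bounded (range (indicator {i} :: _ \<Rightarrow> real))"
    by (auto simp: bounded_iff indicator_def intro!: exI[of _ 1])
  have "S t f i - f i = measure_pmf.expectation (P t i) (\<lambda>j. f j - f i)"
    by (simp add: semigroup_op_def integrable_pmf_bounded bf)
  also have "\<bar>\<dots>\<bar> \<le> measure_pmf.expectation (P t i) (\<lambda>j. \<bar>f j - f i\<bar>)"
    using integral_norm_bound[of "measure_pmf (P t i)" "\<lambda>j. f j - f i"] by simp
  also have "\<dots> \<le> measure_pmf.expectation (P t i) (\<lambda>j. 2 * B * (1 - indicator {i} j))"
  proof (intro integral_mono integrable_pmf_bounded bfun bf)
    show "bounded (range (indicator {i} :: _ \<Rightarrow> real))" by (rule bi)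
    show "\<bar>f j - f i\<bar> \<le> 2 * B * (1 - indicator {i} j)" for j
      using assms[of i] assms[of j] by (auto simp: indicator_def)
  qed
  also have "\<dots> = 2 * B * (1 - pmf (P t i) i)"
    by (subst integral_mult_right_zero, subst Bochner_Integration.integral_diff)
      (auto simp: measure_pmf_single intro!: integrable_pmf_bounded bounded_const_fun bi)
  finally show ?thesis .
qed

text \<open>
  By the semigroup law \<open>S v f - S u f = S (v - u) (S u f) - S u f\<close>, and \<open>S u f\<close> has the same bound as
  \<open>f\<close>. The estimate above therefore gives a modulus of continuity that does not depend on \<open>u\<close>, which
  yields continuity from the left as well as from the right.
\<close>

lemma continuous_on_S:
  assumes "bounded (range f)"
  shows "continuous_on {0..} (\<lambda>t. S t f i)"
  unfolding continuous_on_iff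
proof safe
  fix s e :: real assume s: "0 \<le> s" and e: "0 < e"
  obtain B where B: "\<And>i. \<bar>f i\<bar> \<le> B"
    using assms by (auto simp: bounded_iff)
  have "((\<lambda>t. 2 * B * (1 - pmf (P t i) i)) \<longlongrightarrow> 2 * B * (1 - 1)) (at_right 0)"
    by (intro tendsto_intros P_standard)
  then have "eventually (\<lambda>t. 2 * B * (1 - pmf (P t i) i) < e) (at_right 0)"
    using e by (intro order_tendstoD(2)) auto
  then obtain d where d: "d > 0" "\<And>t. 0 < t \<Longrightarrow> t < d \<Longrightarrow> 2 * B * (1 - pmf (P t i) i) < e"
    unfolding eventually_at_right_field by auto
  have *: "\<bar>S v f i - S u f i\<bar> < e" if "0 \<le> u" "u < v" "v < u + d" for u v
  proof -
    have "S v f i - S u f i = S (v - u) (S u f) i - S u f i"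
      using that by (simp add: S_S assms)
    also have "\<bar>\<dots>\<bar> \<le> 2 * B * (1 - pmf (P (v - u) i) i)"
      by (rule abs_S_minus_le, rule abs_S_le, rule B)
    also have "\<dots> < e"
      using that by (intro d(2)) linarith+
    finally show ?thesis .
  qed
  show "\<exists>d>0. \<forall>x\<in>{0..}. dist x s < d \<longrightarrow> dist (S x f i) (S s f i) < e"
  proof (intro exI conjI ballI impI)
    fix x :: real assume x: "x \<in> {0..}" "dist x s < d"
    consider "x = s" | "x < s" | "s < x" by linarith
    then show "dist (S x f i) (S s f i) < e"
    proof cases
      case 2
      then show ?thesis using *[of x s] x s unfolding dist_real_def by auto
    next
      case 3
      then show ?thesis using *[of s x] x s unfolding dist_real_def by auto
    qed (use e in auto)
  qed (fact d)
qed

section \<open>Exponential decay from the spectral gap\<close>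

lemma S_integrable_on:
  assumes "bounded (range f)" "0 \<le> a"
  shows "(\<lambda>s. S s f i) integrable_on {a..b}"
  using assms
  by (intro integrable_continuous_interval continuous_on_subset[OF continuous_on_S]) auto

text \<open>
  Fubini's theorem. As the state space is countable, joint measurability reduces to
  measurability in \<open>s\<close> for each fixed state, which follows from continuity.
\<close>

lemma expectation_integral_S:
  assumes f: "bounded (range f)" and ab: "0 \<le> a"
  shows "measure_pmf.expectation p (\<lambda>j. integral {a..b} (\<lambda>s. S s f j))
       = (LBINT s:{a..b}. measure_pmf.expectation p (S s f))"
proof -
  obtain B where B: "\<And>i. \<bar>f i\<bar> \<le> B"
    using f by (auto simp: bounded_iff)
  have int: "set_integrable lborel {a..b} (\<lambda>s. S s f j)" for j
    using ab by (intro borel_integrable_atLeastAtMost' continuous_on_subset[OF continuous_on_S] f) auto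
  interpret pair_sigma_finite "measure_pmf p" lborel
    by (intro pair_sigma_finite.intro) (auto intro: measure_pmf.sigma_finite_measure_axioms sigma_finite_lborel)
  define F where "F = (\<lambda>(j, s). indicator {a..b} s *\<^sub>R S s f j)"
  have "F \<in> borel_measurable (count_space UNIV \<Otimes>\<^sub>M lborel)"
    using borel_measurable_integrable[OF int[unfolded set_integrable_def]]
    by (intro measurable_pair_measure_countable1) (auto simp: F_def)
  moreover have "sets (count_space UNIV \<Otimes>\<^sub>M lborel) = sets (measure_pmf p \<Otimes>\<^sub>M lborel)"
    by (intro sets_pair_measure_cong) auto
  ultimately have meas: "F \<in> borel_measurable (measure_pmf p \<Otimes>\<^sub>M lborel)"
    by (metis measurable_cong_sets)
  have bnd: "\<bar>\<integral>s. norm (F (j, s)) \<partial>lborel\<bar> \<le> (\<integral>s. indicator {a..b} s * B \<partial>lborel)" for j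
  proof -
    have "(\<integral>s. norm (F (j, s)) \<partial>lborel) \<le> (\<integral>s. indicator {a..b} s * B \<partial>lborel)"
    proof (rule integral_mono)
      show "integrable lborel (\<lambda>s. norm (F (j, s)))"
        using int[of j] by (auto simp: F_def set_integrable_def intro: integrable_norm)
      show "norm (F (j, s)) \<le> indicator {a..b} s * B" for s
        using abs_S_le[of f B s j, OF B] by (auto simp: F_def indicator_def)
      show "integrable lborel (\<lambda>s. indicator {a..b} s * B)"
        by (intro integrable_mult_left) (cases "a \<le> b", auto simp: integrable_indicator_iff)
    qed
    then show ?thesis by simp
  qed
  have "integrable (measure_pmf p \<Otimes>\<^sub>M lborel) F"
  proof (rule Fubini_integrable[OF meas])
    show "integrable (measure_pmf p) (\<lambda>j. \<integral>s. norm (F (j, s)) \<partial>lborel)"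
      using bnd by (intro integrable_pmf_bounded) (auto simp: bounded_iff simp del: integral_mult_left_zero)
    show "AE j in measure_pmf p. integrable lborel (\<lambda>s. F (j, s))"
      using int by (auto simp: F_def set_integrable_def)
  qed
  then have "(\<integral>s. (\<integral>j. F (j, s) \<partial>measure_pmf p) \<partial>lborel) = (\<integral>j. (\<integral>s. F (j, s) \<partial>lborel) \<partial>measure_pmf p)"
    using Fubini_integral[of "\<lambda>j s. F (j, s)"] by simp
  then show ?thesis
    by (simp add: F_def set_lebesgue_integral_def flip: set_borel_integral_eq_integral(2)[OF int])
qed

text \<open>
  The usual smoothing that makes the domain of a generator dense. It is defined state by state, as
  an integral of a continuous real function.
\<close>

definition time_average :: "real \<Rightarrow> ('e \<Rightarrow> real) \<Rightarrow> 'e \<Rightarrow> real" where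
  "time_average r f i = integral {0..r} (\<lambda>s. S s f i) / r"

lemma abs_integral_S_le:
  assumes B: "\<And>i. \<bar>f i\<bar> \<le> B" and ab: "0 \<le> a" "a \<le> b"
  shows "\<bar>integral {a..b} (\<lambda>s. S s f i)\<bar> \<le> B * (b - a)"
proof -
  have f: "bounded (range f)"
    using B by (auto simp: bounded_iff)
  have "norm (integral {a..b} (\<lambda>s. S s f i)) \<le> B * (b - a)"
    using ab abs_S_le[of f B, OF B]
    by (intro integral_bound continuous_on_subset[OF continuous_on_S[OF f]]) auto
  then show ?thesis
    by simp
qed

lemma abs_time_average_le:
  assumes "\<And>i. \<bar>f i\<bar> \<le> B" "0 < r"
  shows "\<bar>time_average r f i\<bar> \<le> B"
  using abs_integral_S_le[of f B 0 r i] assms by (simp add: time_average_def field_simps)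

lemma bounded_time_average:
  assumes f: "bounded (range f)" and r: "0 < r"
  shows "bounded (range (time_average r f))"
proof -
  from f obtain B where B: "\<And>i. \<bar>f i\<bar> \<le> B"
    by (auto simp: bounded_iff)
  show ?thesis
    using abs_time_average_le[of f B r, OF B r] by (auto simp: bounded_iff)
qed

lemma E_time_average:
  assumes "bounded (range f)" "0 < r"
  shows "E (time_average r f) = E f"
proof -
  have "(LBINT s:{0..r}. E (S s f)) = (LBINT s:{0..r}. E f)"
    using assms by (intro set_lebesgue_integral_cong) (auto simp: E_S)
  then show ?thesis
    using assms by (simp add: time_average_def[abs_def] expectation_integral_S set_integral_const)
qed

lemma S_time_average:
  assumes f: "bounded (range f)" and r: "0 < r" and h: "0 \<le> h"
  shows "S h (time_average r f) i
    = (integral {0..r+h} (\<lambda>s. S s f i) - integral {0..h} (\<lambda>s. S s f i)) / r"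
proof -
  have "S h (time_average r f) i = (LBINT s:{0..r}. measure_pmf.expectation (P h i) (S s f)) / r"
    using f by (simp add: time_average_def[abs_def] semigroup_op_def[of P h] expectation_integral_S)
  also have "(LBINT s:{0..r}. measure_pmf.expectation (P h i) (S s f))
      = (LBINT s:{0..r}. S (h + s) f i)"
  proof (rule set_lebesgue_integral_cong)
    show "\<forall>s. s \<in> {0..r} \<longrightarrow> measure_pmf.expectation (P h i) (S s f) = S (h + s) f i"
      using S_S[OF h _ f] unfolding semigroup_op_def[of P h, symmetric] by auto
  qed auto
  also have "\<dots> = integral {0..r} (\<lambda>s. S (h + s) f i)"
    using h by (intro set_borel_integral_eq_integral borel_integrable_atLeastAtMost'
        continuous_on_compose2[OF continuous_on_S[OF f]] continuous_intros) auto
  also have "\<dots> = integral {h..r+h} (\<lambda>s. S s f i)"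
    using integral_shift_Icc_real[of 0 r "\<lambda>s. S s f i" h] by (simp add: o_def)
  also have "\<dots> = integral {0..r+h} (\<lambda>s. S s f i) - integral {0..h} (\<lambda>s. S s f i)"
    using Henstock_Kurzweil_Integration.integral_combine[of 0 h "r+h" "\<lambda>s. S s f i"] h r S_integrable_on[OF f] by simp
  finally show ?thesis .
qed

lemma integral_S_deriv:
  assumes f: "bounded (range f)" and r: "0 \<le> r"
  shows "((\<lambda>h. (integral {0..r+h} (\<lambda>s. S s f i) - integral {0..r} (\<lambda>s. S s f i)) / h)
    \<longlongrightarrow> S r f i) (at_right 0)"
proof -
  have "((\<lambda>x. integral {0..x} (\<lambda>s. S s f i)) has_real_derivative S r f i) (at r within {0..r+1})"
    using r by (intro integral_has_real_derivative continuous_on_subset[OF continuous_on_S[OF f]]) auto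
  then have "((\<lambda>x. integral {0..x} (\<lambda>s. S s f i)) has_real_derivative S r f i) (at r within {r..r+1})"
    by (rule DERIV_subset) (use r in auto)
  then have "((\<lambda>x. integral {0..x} (\<lambda>s. S s f i)) has_real_derivative S r f i) (at_right r)"
    using at_within_Icc_at_right[of r "r+1"] by simp
  then have "((\<lambda>y. (integral {0..y} (\<lambda>s. S s f i) - integral {0..r} (\<lambda>s. S s f i)) / (y - r))
    \<longlongrightarrow> S r f i) (at_right r)"
    by (simp add: has_field_derivative_iff)
  then show ?thesis
    by (subst (asm) at_right_to_0) (simp add: filterlim_filtermap add.commute)
qed

lemma time_average_tendsto:
  assumes "bounded (range f)"
  shows "((\<lambda>r. time_average r f i) \<longlongrightarrow> f i) (at_right 0)"
  using integral_S_deriv[OF assms, of 0 i] by (simp add: time_average_def)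

lemma norm_L2_eq: "norm_L2 \<pi> f = sqrt (E (\<lambda>i. (f i)\<^sup>2))"
  by (simp add: norm_L2_def inner_L2_def power2_eq_square)

lemma bounded_in_L2: "bounded (range f) \<Longrightarrow> f \<in> L2 \<pi>"
  by (simp add: L2_def integrable_pmf_bounded bounded_power2_real)

text \<open>
  The difference quotient of the average at time \<open>t\<close> is \<open>1 / r\<close> times the difference of the means of
  \<open>s \<mapsto> S s f i\<close> over \<open>{r..r+t}\<close> and over \<open>{0..t}\<close>. These means are bounded by the bound of \<open>f\<close> and converge to the
  values at \<open>r\<close> and at \<open>0\<close>, so the convergence in \<open>L\<^sup>2(\<pi>)\<close> follows from bounded convergence.
\<close>

lemma generator_limit_time_average:
  assumes f: "bounded (range f)" and r: "0 < r"
  shows "generator_limit \<pi> P (time_average r f) (\<lambda>i. (S r f i - f i) / r)"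
proof -
  let ?G = "\<lambda>i x. integral {0..x} (\<lambda>s. S s f i)"
  obtain B where B: "\<And>i. \<bar>f i\<bar> \<le> B"
    using f by (auto simp: bounded_iff)
  define d where "d t i = (S t (time_average r f) i - time_average r f i) / t - (S r f i - f i) / r" for t i
  have quot: "(S t (time_average r f) i - time_average r f i) / t
      = ((?G i (r + t) - ?G i r) / t - (?G i (0 + t) - ?G i 0) / t) / r" if "t > 0" for t i
    using that r by (simp add: S_time_average[OF f r] time_average_def field_simps)
  have lim: "((\<lambda>t. (d t i)\<^sup>2) \<longlongrightarrow> 0) (at_right 0)" for i
  proof -
    have "((\<lambda>t. ((?G i (r + t) - ?G i r) / t - (?G i (0 + t) - ?G i 0) / t) / r)
        \<longlongrightarrow> (S r f i - S 0 f i) / r) (at_right 0)"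
      using r by (intro tendsto_intros integral_S_deriv f) auto
    then have "((\<lambda>t. (S t (time_average r f) i - time_average r f i) / t)
        \<longlongrightarrow> (S r f i - S 0 f i) / r) (at_right 0)"
      by (rule Lim_transform_eventually)
        (auto simp: quot eventually_at_filter)
    then have "((\<lambda>t. (d t i)\<^sup>2) \<longlongrightarrow> ((S r f i - S 0 f i) / r - (S r f i - f i) / r)\<^sup>2) (at_right 0)"
      unfolding d_def by (intro tendsto_power tendsto_diff tendsto_const)
    then show ?thesis by simp
  qed
  have bnd: "\<bar>(d t i)\<^sup>2\<bar> \<le> (4 * B / r)\<^sup>2" if t: "t > 0" for t i
  proof -
    have 1: "?G i (r + t) - ?G i r = integral {r..r+t} (\<lambda>s. S s f i)"
      using Henstock_Kurzweil_Integration.integral_combine[of 0 r "r+t" "\<lambda>s. S s f i"] r t S_integrable_on[OF f, of 0 i "r+t"] by simp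
    have "\<bar>?G i (r + t) - ?G i r\<bar> \<le> B * t"
      unfolding 1 using abs_integral_S_le[of f B r "r+t", OF B] r t by simp
    then have "\<bar>(?G i (r + t) - ?G i r) / t\<bar> \<le> B"
      using t by (simp add: field_simps)
    moreover have "\<bar>?G i t / t\<bar> \<le> B"
      using abs_integral_S_le[of f B 0 t, OF B] t by (simp add: field_simps)
    moreover have "\<bar>S r f i\<bar> \<le> B" "\<bar>f i\<bar> \<le> B"
      by (auto intro!: abs_S_le B)
    ultimately have "\<bar>(?G i (r + t) - ?G i r) / t - ?G i t / t - (S r f i - f i)\<bar> \<le> 4 * B"
      by linarith
    moreover have "d t i = ((?G i (r + t) - ?G i r) / t - ?G i t / t - (S r f i - f i)) / r"
      using quot[OF t, of i] by (simp add: d_def diff_divide_distrib)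
    ultimately have "\<bar>d t i\<bar> \<le> 4 * B / r"
      using r by (simp add: divide_right_mono)
    then have "\<bar>d t i\<bar>\<^sup>2 \<le> (4 * B / r)\<^sup>2"
      by (intro power_mono) auto
    then show ?thesis by simp
  qed
  have "((\<lambda>t. E (\<lambda>i. (d t i)\<^sup>2)) \<longlongrightarrow> E (\<lambda>i. 0)) (at_right 0)"
    using bnd lim by (rule expectation_pmf_tendsto)
  then have "((\<lambda>t. sqrt (E (\<lambda>i. (d t i)\<^sup>2))) \<longlongrightarrow> 0) (at_right 0)"
    using tendsto_real_sqrt by fastforce
  moreover have "bounded (range (\<lambda>i. (S r f i - f i) / r))"
    by (intro bfun f)
  ultimately show ?thesis
    unfolding generator_limit_def norm_L2_eq d_def by (simp add: bounded_in_L2)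
qed

lemma pmf_times_le_E:
  assumes "integrable (measure_pmf \<pi>) u" "\<And>i. (0::real) \<le> u i"
  shows "pmf \<pi> i * u i \<le> E u"
proof -
  have "pmf \<pi> i * u i = E (\<lambda>j. u j * indicator {i} j)"
    by (subst integral_measure_pmf_real[where A = "{i}"]) (auto simp: indicator_def)
  also have "\<dots> \<le> E u"
    using assms by (intro integral_mono integrable_real_mult_indicator) (auto simp: indicator_def)
  finally show ?thesis .
qed

lemma E_square_0:
  assumes "bounded (range f)" "E (\<lambda>i. (f i)\<^sup>2) = 0"
  shows "f i = 0"
  using pmf_times_le_E[of "\<lambda>i. (f i)\<^sup>2" i] assms full_support[of i]
  by (auto simp: integrable_pmf_bounded bounded_power2_real mult_le_0_iff)

text \<open>
  Since \<open>\<pi>\<close> charges \<open>i\<close>, convergence in \<open>L\<^sup>2(\<pi>)\<close> implies convergence at \<open>i\<close>. This makes the definite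
  description in the definition of the generator meaningful. The function \<open>h\<close> may be unbounded, so
  integrability of the squared error has to be established first: an integral of a function that is
  not integrable would be \<open>0\<close> by convention and would say nothing.
\<close>

lemma generator_limit_pointwise:
  assumes f: "bounded (range f)" and gl: "generator_limit \<pi> P f h"
  shows "((\<lambda>t. (S t f i - f i) / t) \<longlongrightarrow> h i) (at_right 0)"
proof -
  define d where "d t i = (S t f i - f i) / t - h i" for t i
  have int: "integrable (measure_pmf \<pi>) (\<lambda>i. (d t i)\<^sup>2)" for t
  proof -
    have "bounded (range (\<lambda>i. (S t f i - f i) / t))"
      by (intro bfun f)
    then obtain B where B: "\<And>i. \<bar>(S t f i - f i) / t\<bar> \<le> B"
      unfolding bounded_iff by auto
    have "(d t i)\<^sup>2 \<le> 2 * B\<^sup>2 + 2 * (h i)\<^sup>2" for i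
    proof -
      have "(d t i)\<^sup>2 \<le> 2 * ((S t f i - f i) / t)\<^sup>2 + 2 * (h i)\<^sup>2"
        using zero_le_power2[of "(S t f i - f i) / t + h i"]
        by (simp add: d_def power2_sum power2_diff)
      moreover have "((S t f i - f i) / t)\<^sup>2 \<le> B\<^sup>2"
        using power_mono[OF B, of i 2] by (simp only: power2_abs)
      ultimately show ?thesis by linarith
    qed
    then have "AE i in measure_pmf \<pi>. norm ((d t i)\<^sup>2) \<le> norm (2 * B\<^sup>2 + 2 * (h i)\<^sup>2)"
      by simp
    moreover have "integrable (measure_pmf \<pi>) (\<lambda>i. 2 * B\<^sup>2 + 2 * (h i)\<^sup>2)"
      using gl by (simp add: generator_limit_def L2_def)
    ultimately show ?thesis
      by (rule Bochner_Integration.integrable_bound[rotated 2]) simp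
  qed
  have lim: "((\<lambda>t. sqrt (E (\<lambda>i. (d t i)\<^sup>2)) / sqrt (pmf \<pi> i)) \<longlongrightarrow> 0) (at_right 0)"
    using gl unfolding generator_limit_def norm_L2_eq d_def by (intro tendsto_divide_zero) simp
  have "norm (d t i) \<le> sqrt (E (\<lambda>i. (d t i)\<^sup>2)) / sqrt (pmf \<pi> i)" for t
  proof -
    have "pmf \<pi> i * (d t i)\<^sup>2 \<le> E (\<lambda>i. (d t i)\<^sup>2)"
      by (rule pmf_times_le_E[OF int]) simp
    then have "sqrt ((d t i)\<^sup>2) \<le> sqrt (E (\<lambda>i. (d t i)\<^sup>2) / pmf \<pi> i)"
      using full_support[of i] by (intro real_sqrt_le_mono) (simp add: field_simps)
    then show ?thesis by (simp add: real_sqrt_divide)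
  qed
  then have "((\<lambda>t. d t i) \<longlongrightarrow> 0) (at_right 0)"
    by (rule Lim_null_comparison[OF always_eventually[OF allI] lim])
  then show ?thesis
    unfolding d_def by (simp add: LIM_zero_iff)
qed

lemma generator_eqI:
  assumes "bounded (range f)" "generator_limit \<pi> P f h"
  shows "generator \<pi> P f = h"
  unfolding generator_def
proof (rule the_equality)
  show "k = h" if "generator_limit \<pi> P f k" for k
    by (rule ext, rule tendsto_unique[OF trivial_limit_at_right_real
          generator_limit_pointwise[OF assms(1) that] generator_limit_pointwise[OF assms]])
qed fact

lemma generator_limit_divide:
  assumes "generator_limit \<pi> P f h"
  shows "generator_limit \<pi> P (\<lambda>i. f i / c) (\<lambda>i. h i / c)"
proof -
  have "norm_L2 \<pi> (\<lambda>i. (S t (\<lambda>i. f i / c) i - f i / c) / t - h i / c)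
      = norm_L2 \<pi> (\<lambda>i. (S t f i - f i) / t - h i) / \<bar>c\<bar>" for t
  proof -
    have "(S t (\<lambda>i. f i / c) i - f i / c) / t - h i / c = ((S t f i - f i) / t - h i) / c" for i
      by (simp add: S_divide diff_divide_distrib mult.commute)
    then show ?thesis
      by (simp add: norm_L2_eq power_divide real_sqrt_divide)
  qed
  moreover have "((\<lambda>t. norm_L2 \<pi> (\<lambda>i. (S t f i - f i) / t - h i) / \<bar>c\<bar>) \<longlongrightarrow> 0) (at_right 0)"
    using assms unfolding generator_limit_def by (intro tendsto_divide_zero) auto
  ultimately show ?thesis
    using assms by (simp add: generator_limit_def L2_def power_divide)
qed

text \<open>
  The definition of the spectral gap only speaks about functions of norm \<open>1\<close>; this is its homogeneous form.
\<close>

lemma dirichlet_form_ge: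
  assumes f: "bounded (range f)" and mean: "E f = 0" and gl: "generator_limit \<pi> P f h"
    and gap: "ereal \<gamma> \<le> spectral_gap \<pi> P"
  shows "E (\<lambda>i. f i * h i) \<le> - \<gamma> * E (\<lambda>i. (f i)\<^sup>2)"
proof (cases "E (\<lambda>i. (f i)\<^sup>2) = 0")
  case True
  then show ?thesis
    using E_square_0[OF f True] by simp
next
  case False
  define c where "c = sqrt (E (\<lambda>i. (f i)\<^sup>2))"
  have pos: "0 < E (\<lambda>i. (f i)\<^sup>2)"
    using False by (simp add: order_less_le Bochner_Integration.integral_nonneg)
  then have c: "c > 0" "c\<^sup>2 = E (\<lambda>i. (f i)\<^sup>2)"
    by (auto simp: c_def)
  have gl': "generator_limit \<pi> P (\<lambda>i. f i / c) (\<lambda>i. h i / c)"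
    by (rule generator_limit_divide[OF gl])
  have bf: "bounded (range (\<lambda>i. f i / c))"
    by (intro bfun f)
  have "(\<lambda>i. f i / c) \<in> {f \<in> generator_domain \<pi> P. norm_L2 \<pi> f = 1 \<and> E f = 0}"
    using gl' bounded_in_L2[OF bf] mean c False
    by (auto simp: generator_domain_def norm_L2_eq power_divide)
  then have "ereal \<gamma> \<le> ereal (- inner_L2 \<pi> (generator \<pi> P (\<lambda>i. f i / c)) (\<lambda>i. f i / c))"
    using gap unfolding spectral_gap_def by (meson INF_lower order_trans)
  also have "\<dots> = ereal (- (E (\<lambda>i. f i * h i) / c\<^sup>2))"
    by (simp add: generator_eqI[OF bf gl'] inner_L2_def power2_eq_square mult.commute)
  finally show ?thesis
    using c pos by (simp add: field_simps)
qed

text \<open>The error at time \<open>s\<close> is the image under the contraction \<open>S s\<close> of the error at time \<open>0\<close>.\<close>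

lemma generator_limit_S:
  assumes f: "bounded (range f)" and h: "bounded (range h)" and s: "0 \<le> s"
    and gl: "generator_limit \<pi> P f h"
  shows "generator_limit \<pi> P (S s f) (S s h)"
proof -
  let ?d = "\<lambda>t i. (S t f i - f i) / t - h i"
  have "norm_L2 \<pi> (\<lambda>i. (S t (S s f) i - S s f i) / t - S s h i) \<le> norm_L2 \<pi> (?d t)" if "t > 0" for t
  proof -
    have bd: "bounded (range (?d t))"
      by (intro bfun f h)
    have "(\<lambda>i. (S t (S s f) i - S s f i) / t - S s h i) = S s (?d t)"
    proof -
      have "S s (?d t) = (\<lambda>i. S s (\<lambda>i. (S t f i - f i) / t) i - S s h i)"
        by (rule S_diff) (intro bfun f h)+
      also have "S s (\<lambda>i. (S t f i - f i) / t) = (\<lambda>i. (S s (S t f) i - S s f i) / t)"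
        unfolding S_divide by (subst S_diff) (intro bfun f refl)+
      also have "S s (S t f) = S t (S s f)"
        using that s f by (simp add: S_S add.commute)
      finally show ?thesis by (rule sym)
    qed
    then show ?thesis
      using E_S_square_le[OF s bd] by (simp add: norm_L2_eq)
  qed
  then have le: "\<forall>\<^sub>F t in at_right 0. norm_L2 \<pi> (\<lambda>i. (S t (S s f) i - S s f i) / t - S s h i) \<le> norm_L2 \<pi> (?d t)"
    by (simp add: eventually_at_filter)
  have nn: "\<forall>\<^sub>F t in at_right 0. 0 \<le> norm_L2 \<pi> (\<lambda>i. (S t (S s f) i - S s f i) / t - S s h i)"
    by (intro always_eventually allI) (simp add: norm_L2_eq)
  have lim: "((\<lambda>t. norm_L2 \<pi> (?d t)) \<longlongrightarrow> 0) (at_right 0)"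
    using gl by (simp add: generator_limit_def)
  have "((\<lambda>t. norm_L2 \<pi> (\<lambda>i. (S t (S s f) i - S s f i) / t - S s h i)) \<longlongrightarrow> 0) (at_right 0)"
    by (rule tendsto_sandwich[OF nn le tendsto_const lim])
  then show ?thesis
    by (simp add: generator_limit_def bounded_in_L2 bfun h)
qed

text \<open>
  The differential inequality \<open>\<phi>' \<le> - 2 \<gamma> \<phi>\<close> for \<open>\<phi> s = E ((S s f)\<^sup>2)\<close> is integrated by Euler steps. A
  step of length \<open>\<delta>\<close> from time \<open>s\<close> moves \<open>S s f\<close> by \<open>\<delta> * S s (h + r)\<close>, where the remainder
  \<open>r = (S \<delta> f - f) / \<delta> - h\<close> is the same for every \<open>s\<close>. As the semigroup is contractive, the
  errors of the \<open>t / \<delta>\<close> steps are bounded uniformly in \<open>s\<close> and add up to something that vanishes with \<open>\<delta>\<close>.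
\<close>

lemma spectral_decay_domain:
  assumes f: "bounded (range f)" and h: "bounded (range h)" and mean: "E f = 0"
    and gl: "generator_limit \<pi> P f h"
    and gap: "ereal \<gamma> \<le> spectral_gap \<pi> P" and gamma: "0 \<le> \<gamma>" and t: "0 < t"
  shows "E (\<lambda>i. (S t f i)\<^sup>2) \<le> exp (- 2 * \<gamma> * t) * E (\<lambda>i. (f i)\<^sup>2)"
proof -
  define r where "r \<delta> i = (S \<delta> f i - f i) / \<delta> - h i" for \<delta> i
  define \<rho> where "\<rho> \<delta> = norm_L2 \<pi> (r \<delta>)" for \<delta>
  define err where "err \<delta> = 2 * norm_L2 \<pi> f * \<rho> \<delta> + \<delta> * (2 * E (\<lambda>i. (h i)\<^sup>2) + 2 * (\<rho> \<delta>)\<^sup>2)" for \<delta>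
  have br: "bounded (range (r \<delta>))" for \<delta>
    unfolding r_def by (intro bfun f h)
  have \<rho>2: "E (\<lambda>i. (r \<delta> i)\<^sup>2) = (\<rho> \<delta>)\<^sup>2" for \<delta>
    by (simp add: \<rho>_def norm_L2_eq)
  have step: "E (\<lambda>i. (S (s + \<delta>) f i)\<^sup>2) \<le> (1 - 2 * \<gamma> * \<delta>) * E (\<lambda>i. (S s f i)\<^sup>2) + \<delta> * err \<delta>"
    if s: "0 \<le> s" and d: "0 < \<delta>" for s \<delta>
  proof -
    define u where "u = S s f"
    define v where "v = S s (r \<delta>)"
    define k where "k = S s h"
    have bd: "bounded (range u)" "bounded (range v)" "bounded (range k)"
      unfolding u_def v_def k_def by (intro bfun f h br)+
    have bhr: "bounded (range (\<lambda>i. h i + r \<delta> i))"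
      by (intro bfun h br)
    have "S \<delta> f = (\<lambda>i. f i + \<delta> * (h i + r \<delta> i))"
      using d by (simp add: r_def fun_eq_iff field_simps)
    then have "S s (S \<delta> f) = S s (\<lambda>i. f i + \<delta> * (h i + r \<delta> i))"
      by simp
    also have "\<dots> = (\<lambda>i. S s f i + S s (\<lambda>i. \<delta> * (h i + r \<delta> i)) i)"
      by (rule S_add) (intro bfun f h br)+
    also have "\<dots> = (\<lambda>i. u i + \<delta> * (k i + v i))"
      unfolding S_mult S_add[OF h br] u_def k_def v_def ..
    finally have "S s (S \<delta> f) = (\<lambda>i. u i + \<delta> * (k i + v i))" .
    then have eq: "S (s + \<delta>) f = (\<lambda>i. u i + \<delta> * (k i + v i))"
      using s d f by (simp add: S_S)
    have uk: "E (\<lambda>i. u i * k i) \<le> - \<gamma> * E (\<lambda>i. (u i)\<^sup>2)"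
      unfolding u_def k_def
      by (rule dirichlet_form_ge[OF _ _ generator_limit_S[OF f h s gl] gap])
        (use bd mean s f in \<open>auto simp: E_S u_def\<close>)
    have "E (\<lambda>i. u i * v i) \<le> norm_L2 \<pi> u * norm_L2 \<pi> v"
      using expectation_pmf_Cauchy_Schwarz[OF bd(1,2), of \<pi>] by (simp add: norm_L2_eq)
    also have "\<dots> \<le> norm_L2 \<pi> f * \<rho> \<delta>"
      unfolding \<rho>_def norm_L2_eq u_def v_def
      by (intro mult_mono real_sqrt_le_mono E_S_square_le f s br) auto
    finally have uv: "E (\<lambda>i. u i * v i) \<le> norm_L2 \<pi> f * \<rho> \<delta>" .
    have "E (\<lambda>i. (k i + v i)\<^sup>2) \<le> E (\<lambda>i. 2 * (k i)\<^sup>2 + 2 * (v i)\<^sup>2)"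
    proof (intro integral_mono integrable_pmf_bounded bfun bd)
      show "(k i + v i)\<^sup>2 \<le> 2 * (k i)\<^sup>2 + 2 * (v i)\<^sup>2" for i
        using zero_le_power2[of "k i - v i"] by (simp add: power2_sum power2_diff)
    qed
    also have "\<dots> = 2 * E (\<lambda>i. (k i)\<^sup>2) + 2 * E (\<lambda>i. (v i)\<^sup>2)"
      using bd by (simp add: integrable_pmf_bounded bounded_power2_real)
    also have "\<dots> \<le> 2 * E (\<lambda>i. (h i)\<^sup>2) + 2 * (\<rho> \<delta>)\<^sup>2"
      using E_S_square_le[OF s h] E_S_square_le[OF s br, of \<delta>] by (simp add: k_def v_def \<rho>2)
    finally have kv: "E (\<lambda>i. (k i + v i)\<^sup>2) \<le> 2 * E (\<lambda>i. (h i)\<^sup>2) + 2 * (\<rho> \<delta>)\<^sup>2" .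
    have "(\<lambda>i. (S (s + \<delta>) f i)\<^sup>2)
        = (\<lambda>i. (u i)\<^sup>2 + (2 * \<delta>) * (u i * k i) + (2 * \<delta>) * (u i * v i) + \<delta>\<^sup>2 * (k i + v i)\<^sup>2)"
      unfolding eq by (simp add: fun_eq_iff power2_eq_square algebra_simps)
    then have "E (\<lambda>i. (S (s + \<delta>) f i)\<^sup>2) = E (\<lambda>i. (u i)\<^sup>2) + (2 * \<delta>) * E (\<lambda>i. u i * k i)
        + (2 * \<delta>) * E (\<lambda>i. u i * v i) + \<delta>\<^sup>2 * E (\<lambda>i. (k i + v i)\<^sup>2)"
      using bd by (simp add: integrable_pmf_bounded bounded_mult_real bounded_power2_real bounded_plus_comp)
    also have "\<dots> \<le> E (\<lambda>i. (u i)\<^sup>2) + (2 * \<delta>) * (- \<gamma> * E (\<lambda>i. (u i)\<^sup>2))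
        + (2 * \<delta>) * (norm_L2 \<pi> f * \<rho> \<delta>) + \<delta>\<^sup>2 * (2 * E (\<lambda>i. (h i)\<^sup>2) + 2 * (\<rho> \<delta>)\<^sup>2)"
      using d uk uv kv by (intro add_mono mult_left_mono) auto
    also have "\<dots> = (1 - 2 * \<gamma> * \<delta>) * E (\<lambda>i. (S s f i)\<^sup>2) + \<delta> * err \<delta>"
      by (simp add: err_def u_def power2_eq_square algebra_simps)
    finally show ?thesis .
  qed
  have err_nonneg: "0 \<le> err \<delta>" if "0 < \<delta>" for \<delta>
    using that by (auto simp: err_def \<rho>_def norm_L2_eq intro!: add_nonneg_nonneg mult_nonneg_nonneg)
  have exp_bound: "E (\<lambda>i. (S (real n * \<delta>) f i)\<^sup>2)
      \<le> exp (- 2 * \<gamma> * \<delta>) ^ n * E (\<lambda>i. (f i)\<^sup>2) + real n * \<delta> * err \<delta>"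
    if d: "0 < \<delta>" for n \<delta>
  proof (induction n)
    case (Suc n)
    let ?q = "exp (- 2 * \<gamma> * \<delta>)"
    have q: "?q \<le> 1"
      using d gamma by simp
    have "E (\<lambda>i. (S (real (Suc n) * \<delta>) f i)\<^sup>2)
        \<le> (1 - 2 * \<gamma> * \<delta>) * E (\<lambda>i. (S (real n * \<delta>) f i)\<^sup>2) + \<delta> * err \<delta>"
      using step[of "real n * \<delta>" \<delta>] d by (simp add: algebra_simps)
    also have "\<dots> \<le> ?q * E (\<lambda>i. (S (real n * \<delta>) f i)\<^sup>2) + \<delta> * err \<delta>"
      using exp_ge_add_one_self[of "- 2 * \<gamma> * \<delta>"] err_nonneg[OF d] by (intro add_mono mult_right_mono) auto
    also have "\<dots> \<le> ?q * (?q ^ n * E (\<lambda>i. (f i)\<^sup>2) + real n * \<delta> * err \<delta>) + \<delta> * err \<delta>"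
      using Suc.IH by (intro add_right_mono mult_left_mono) auto
    also have "\<dots> \<le> ?q ^ Suc n * E (\<lambda>i. (f i)\<^sup>2) + 1 * (real n * \<delta> * err \<delta>) + \<delta> * err \<delta>"
    proof -
      have "?q * (real n * \<delta> * err \<delta>) \<le> 1 * (real n * \<delta> * err \<delta>)"
        using q d err_nonneg[OF d] by (intro mult_right_mono) auto
      then show ?thesis by (simp add: distrib_left mult.assoc)
    qed
    also have "\<dots> = ?q ^ Suc n * E (\<lambda>i. (f i)\<^sup>2) + real (Suc n) * \<delta> * err \<delta>"
      by (simp add: algebra_simps)
    finally show ?case .
  qed simp
  have rho_lim: "(\<rho> \<longlongrightarrow> 0) (at_right 0)"
    using gl by (simp add: generator_limit_def \<rho>_def[abs_def] r_def[abs_def])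
  have id_lim: "((\<lambda>\<delta>::real. \<delta>) \<longlongrightarrow> 0) (at_right 0)"
    by (rule tendsto_ident_at)
  have "(err \<longlongrightarrow> 2 * norm_L2 \<pi> f * 0 + 0 * (2 * E (\<lambda>i. (h i)\<^sup>2) + 2 * 0\<^sup>2)) (at_right 0)"
    unfolding err_def[abs_def] by (intro tendsto_intros rho_lim id_lim)
  then have err_lim: "(err \<longlongrightarrow> 0) (at_right 0)"
    by simp
  have "(\<lambda>n. t / real (Suc n)) \<longlonglongrightarrow> 0"
    by (rule LIMSEQ_Suc, rule lim_const_over_n)
  then have sub: "filterlim (\<lambda>n. t / real (Suc n)) (at_right 0) sequentially"
    using t by (auto simp: filterlim_at)
  have "(\<lambda>n. exp (- 2 * \<gamma> * t) * E (\<lambda>i. (f i)\<^sup>2) + t * err (t / real (Suc n)))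
      \<longlonglongrightarrow> exp (- 2 * \<gamma> * t) * E (\<lambda>i. (f i)\<^sup>2) + t * 0"
    by (intro tendsto_intros filterlim_compose[OF err_lim sub])
  moreover have "E (\<lambda>i. (S t f i)\<^sup>2)
      \<le> exp (- 2 * \<gamma> * t) * E (\<lambda>i. (f i)\<^sup>2) + t * err (t / real (Suc n))" for n
  proof -
    have e1: "real (Suc n) * (t / real (Suc n)) = t"
      by simp
    have e2: "exp (- 2 * \<gamma> * (t / real (Suc n))) ^ Suc n = exp (- 2 * \<gamma> * t)"
      by (subst exp_of_nat_mult[symmetric]) simp
    have "0 < t / real (Suc n)"
      using t by simp
    from exp_bound[OF this, of "Suc n"] show ?thesis
      unfolding e1 e2 .
  qed
  ultimately show ?thesis
    using LIMSEQ_le_const[of _ _ "E (\<lambda>i. (S t f i)\<^sup>2)"] by simp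
qed

text \<open>
  Both sides are continuous along the time averages of \<open>f\<close>, which belong to the domain of the
  generator and have the same mean as \<open>f\<close>.
\<close>

theorem spectral_decay:
  assumes f: "bounded (range f)" and mean: "E f = 0"
    and gap: "ereal \<gamma> \<le> spectral_gap \<pi> P" and gamma: "0 \<le> \<gamma>" and t: "0 < t"
  shows "E (\<lambda>i. (S t f i)\<^sup>2) \<le> exp (- 2 * \<gamma> * t) * E (\<lambda>i. (f i)\<^sup>2)"
proof -
  obtain B where B: "\<And>i. \<bar>f i\<bar> \<le> B"
    using f by (auto simp: bounded_iff)
  have ta: "\<bar>time_average r f i\<bar> \<le> B" if "r > 0" for r i
    by (rule abs_time_average_le[OF B that])
  have S_ta: "((\<lambda>r. S t (time_average r f) i) \<longlongrightarrow> S t f i) (at_right 0)" for i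
    unfolding semigroup_op_def[of P t]
    by (rule expectation_pmf_tendsto[OF ta time_average_tendsto[OF f]])
  have sq: "\<bar>(x::real)\<^sup>2\<bar> \<le> B\<^sup>2" if "\<bar>x\<bar> \<le> B" for x
    using power_mono[OF that, of 2] by simp
  have "((\<lambda>r. E (\<lambda>i. (S t (time_average r f) i)\<^sup>2)) \<longlongrightarrow> E (\<lambda>i. (S t f i)\<^sup>2)) (at_right 0)"
    by (rule expectation_pmf_tendsto[OF sq tendsto_power[OF S_ta]]) (rule abs_S_le, rule ta)
  moreover have "((\<lambda>r. E (\<lambda>i. (time_average r f i)\<^sup>2)) \<longlongrightarrow> E (\<lambda>i. (f i)\<^sup>2)) (at_right 0)"
    by (rule expectation_pmf_tendsto[OF sq tendsto_power[OF time_average_tendsto[OF f]]]) (rule ta)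
  then have "((\<lambda>r. exp (- 2 * \<gamma> * t) * E (\<lambda>i. (time_average r f i)\<^sup>2))
      \<longlongrightarrow> exp (- 2 * \<gamma> * t) * E (\<lambda>i. (f i)\<^sup>2)) (at_right 0)"
    by (rule tendsto_mult_left)
  moreover have "E (\<lambda>i. (S t (time_average r f) i)\<^sup>2)
      \<le> exp (- 2 * \<gamma> * t) * E (\<lambda>i. (time_average r f i)\<^sup>2)" if r: "0 < r" for r
  proof (rule spectral_decay_domain[OF _ _ _ generator_limit_time_average[OF f r] gap gamma t])
    show "bounded (range (\<lambda>i. (S r f i - f i) / r))"
      by (intro bfun f)
  qed (use f r mean in \<open>auto simp: bounded_time_average E_time_average\<close>)
  then have "\<forall>\<^sub>F r in at_right 0. E (\<lambda>i. (S t (time_average r f) i)\<^sup>2)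
      \<le> exp (- 2 * \<gamma> * t) * E (\<lambda>i. (time_average r f i)\<^sup>2)"
    by (simp add: eventually_at_filter)
  ultimately show ?thesis
    by (intro tendsto_le[OF trivial_limit_at_right_real])
qed

end

section \<open>The exponentially tilted transition operator\<close>

text \<open>
  For \<open>N = 1\<close> and \<open>w \<ge> 0\<close> the function \<open>w\<^sup>2\<close> is a density, and the left-hand side is the difference between the
  expectations of \<open>f\<close> under this density and under \<open>p\<close>. It is at most \<open>b - a\<close> times the total
  variation distance, which is at most \<open>sqrt (1 - c\<^sup>2)\<close> with \<open>c\<close> the Hellinger affinity. The
  factorisation \<open>w\<^sup>2 - N = (w - sqrt N) * (w + sqrt N)\<close> and the Cauchy-Schwarz inequality give
  this for \<open>w\<close> of any sign. Using \<open>sqrt (1 - c\<^sup>2)\<close>, and not a cruder bound with the same order of magnitude,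
  is what leads to the constant \<open>1\<close> in the exponent of the final estimate.
\<close>

lemma expectation_times_square_le:
  fixes f w :: "'a \<Rightarrow> real"
  assumes mean: "measure_pmf.expectation p f = 0" and range: "\<And>i. a \<le> f i" "\<And>i. f i \<le> b"
    and w: "bounded (range w)"
  defines "N \<equiv> measure_pmf.expectation p (\<lambda>i. (w i)\<^sup>2)"
    and "c \<equiv> measure_pmf.expectation p w"
  shows "measure_pmf.expectation p (\<lambda>i. f i * (w i)\<^sup>2) \<le> (b - a) * (sqrt N * sqrt (N - c\<^sup>2))"
proof -
  define n where "n = sqrt N"
  \<comment> \<open>around the midpoint, \<open>f\<close> deviates by at most half of \<open>b - a\<close>; centring there costs nothing, because
    \<open>w\<^sup>2 - N\<close> has mean zero\<close>
  define m where "m = (a + b) / 2"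
  have f: "bounded (range f)"
    using range by (auto simp: bounded_iff intro!: exI[of _ "max \<bar>a\<bar> \<bar>b\<bar>"]) (smt (verit))
  have ab: "a \<le> b"
    using range order_trans by blast
  have N: "0 \<le> N"
    by (simp add: N_def)
  then have n2: "n\<^sup>2 = N"
    by (simp add: n_def)
  have int: "integrable (measure_pmf p) (\<lambda>i. f i * (w i)\<^sup>2)" "integrable (measure_pmf p) f"
    "integrable (measure_pmf p) (\<lambda>i. (w i)\<^sup>2)" "integrable (measure_pmf p) w"
    by (intro integrable_pmf_intros f w)+
  have "(\<lambda>i. (f i - m) * ((w i - n) * (w i + n)))
      = (\<lambda>i. f i * (w i)\<^sup>2 - N * f i - m * (w i)\<^sup>2 + m * N)"
    by (simp add: fun_eq_iff flip: n2) (simp add: power2_eq_square algebra_simps)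
  then have "measure_pmf.expectation p (\<lambda>i. (f i - m) * ((w i - n) * (w i + n)))
      = measure_pmf.expectation p (\<lambda>i. f i * (w i)\<^sup>2) - N * 0 - m * N + m * N"
    using int by (simp add: mean N_def[symmetric])
  then have "measure_pmf.expectation p (\<lambda>i. f i * (w i)\<^sup>2)
      = measure_pmf.expectation p (\<lambda>i. (f i - m) * ((w i - n) * (w i + n)))"
    by simp
  also have "\<dots> \<le> measure_pmf.expectation p (\<lambda>i. (b - a) / 2 * (\<bar>w i - n\<bar> * \<bar>w i + n\<bar>))"
  proof (intro integral_mono integrable_pmf_intros f w)
    show "(f i - m) * ((w i - n) * (w i + n)) \<le> (b - a) / 2 * (\<bar>w i - n\<bar> * \<bar>w i + n\<bar>)" for i
    proof -
      have "\<bar>f i - m\<bar> \<le> (b - a) / 2"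
        using range[of i] by (simp add: m_def abs_le_iff field_simps)
      then have "\<bar>f i - m\<bar> * \<bar>(w i - n) * (w i + n)\<bar> \<le> (b - a) / 2 * \<bar>(w i - n) * (w i + n)\<bar>"
        by (intro mult_right_mono) auto
      then have "\<bar>(f i - m) * ((w i - n) * (w i + n))\<bar> \<le> (b - a) / 2 * (\<bar>w i - n\<bar> * \<bar>w i + n\<bar>)"
        by (simp only: abs_mult)
      then show ?thesis by linarith
    qed
  qed
  also have "\<dots> \<le> (b - a) / 2 * (sqrt (2 * N - 2 * n * c) * sqrt (2 * N + 2 * n * c))"
  proof -
    have "measure_pmf.expectation p (\<lambda>i. (w i - n)\<^sup>2) = 2 * N - 2 * n * c"
      using int by (simp add: power2_diff mult.assoc n2 N_def[symmetric] c_def[symmetric])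
    moreover have "measure_pmf.expectation p (\<lambda>i. (w i + n)\<^sup>2) = 2 * N + 2 * n * c"
      using int by (simp add: power2_sum mult.assoc n2 N_def[symmetric] c_def[symmetric])
    moreover have "\<bar>measure_pmf.expectation p (\<lambda>i. \<bar>w i - n\<bar> * \<bar>w i + n\<bar>)\<bar>
      \<le> sqrt (measure_pmf.expectation p (\<lambda>i. (w i - n)\<^sup>2)) * sqrt (measure_pmf.expectation p (\<lambda>i. (w i + n)\<^sup>2))"
      using expectation_pmf_Cauchy_Schwarz[of "\<lambda>i. \<bar>w i - n\<bar>" "\<lambda>i. \<bar>w i + n\<bar>" p]
      by (simp add: bounded_fun_intros w)
    ultimately show ?thesis
      using ab by (simp add: mult_left_mono)
  qed
  also have "sqrt (2 * N - 2 * n * c) * sqrt (2 * N + 2 * n * c) = sqrt (4 * (N * (N - c\<^sup>2)))"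
    unfolding real_sqrt_mult[symmetric] by (simp add: power2_eq_square algebra_simps flip: n2)
  also have "\<dots> = 2 * (sqrt N * sqrt (N - c\<^sup>2))"
    by (simp add: real_sqrt_mult)
  finally show ?thesis
    by simp
qed

lemma exp_le_quadratic:
  fixes x :: real
  assumes "x \<le> 1 / 2"
  shows "exp x \<le> 1 + x + 2 * x\<^sup>2"
proof -
  have "1 - x \<le> exp (- x)"
    using exp_ge_add_one_self[of "- x"] by simp
  then have "exp x * (1 - x) \<le> 1"
    by (simp add: exp_minus field_simps)
  also have "1 \<le> (1 + x + 2 * x\<^sup>2) * (1 - x)"
  proof -
    have "(1 + x + 2 * x\<^sup>2) * (1 - x) = 1 + x\<^sup>2 * (1 - 2 * x)"
      by (simp add: power2_eq_square algebra_simps)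
    moreover have "0 \<le> x\<^sup>2 * (1 - 2 * x)"
      using assms by simp
    ultimately show ?thesis by linarith
  qed
  finally show ?thesis
    using assms by (simp add: mult_le_cancel_right)
qed

context stationary_semigroup
begin

text \<open>
  Write \<open>w = S \<delta> h\<close>, \<open>c = E h = E w\<close> and \<open>V = E (w\<^sup>2) - c\<^sup>2\<close>. Up to second order in \<open>\<delta>\<close> the left-hand side is
  \<open>E (w\<^sup>2) + 2 \<delta> \<theta> E (f w\<^sup>2)\<close>. The second term is at most \<open>2 \<delta> (\<gamma> V + L E (w\<^sup>2))\<close> with
  \<open>L = \<theta>\<^sup>2 (b - a)\<^sup>2 / (4 \<gamma>)\<close>, and the decay of variances compensates the summand with \<open>V\<close>:
  \<open>(1 + 2 \<gamma> \<delta>) V \<le> exp (2 \<gamma> \<delta>) V\<close> is at most the variance of \<open>h\<close>. The summand of second order is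
  kept explicit, since it has to be summed over \<open>t / \<delta>\<close> steps.
\<close>

lemma tilted_step_le:
  assumes gap: "ereal \<gamma> \<le> spectral_gap \<pi> P" and gamma: "0 < \<gamma>"
    and mean: "E f = 0" and range: "\<And>i. a \<le> f i" "\<And>i. f i \<le> b"
    and theta: "0 \<le> \<theta>" and d: "0 < \<delta>" and small: "2 * \<delta> * \<theta> * (b - a) \<le> 1 / 2"
    and h: "bounded (range h)"
  shows "E (\<lambda>i. (exp (\<delta> * \<theta> * f i) * S \<delta> h i)\<^sup>2)
    \<le> exp (2 * \<delta> * (\<theta>\<^sup>2 * (b - a)\<^sup>2 / (4 * \<gamma>)) + 8 * \<delta>\<^sup>2 * \<theta>\<^sup>2 * (b - a)\<^sup>2) * E (\<lambda>i. (h i)\<^sup>2)"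
proof -
  define w where "w = S \<delta> h"
  define c where "c = E h"
  define N where "N = E (\<lambda>i. (w i)\<^sup>2)"
  define D where "D = b - a"
  define V where "V = N - c\<^sup>2"
  define L where "L = \<theta>\<^sup>2 * D\<^sup>2 / (4 * \<gamma>)"
  have f: "bounded (range f)"
    using range by (auto simp: bounded_iff intro!: exI[of _ "max \<bar>a\<bar> \<bar>b\<bar>"]) (smt (verit))
  have w: "bounded (range w)"
    unfolding w_def by (rule bounded_S[OF h])
  have wc: "E w = c"
    using d h by (simp add: w_def c_def E_S)
  have "E (\<lambda>_. a) \<le> E f" "E f \<le> E (\<lambda>_. b)"
    using range by (auto intro!: integral_mono integrable_pmf_bounded f simp del: integral_const lebesgue_integral_const)
  then have ab: "a \<le> 0" "0 \<le> b"
    by (auto simp: mean)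
  have absf: "\<bar>f i\<bar> \<le> D" for i
    using range[of i] ab by (auto simp: D_def)
  have D: "0 \<le> D"
    using ab by (simp add: D_def)
  have V_eq: "V = E (\<lambda>i. (S \<delta> (\<lambda>i. h i - c) i)\<^sup>2)"
  proof -
    have "S \<delta> (\<lambda>i. h i - c) = (\<lambda>i. w i - c)"
      by (subst S_diff) (auto simp: w_def intro: h bounded_const_fun)
    moreover have "E (\<lambda>i. (w i - c)\<^sup>2) = E (\<lambda>i. (w i)\<^sup>2 + c\<^sup>2 - (2 * c) * w i)"
      by (simp add: power2_diff mult.assoc mult.commute[of _ c])
    moreover have "\<dots> = N + c\<^sup>2 - (2 * c) * c"
      using w by (simp add: integrable_pmf_intros N_def wc)
    ultimately show ?thesis
      by (simp add: V_def power2_eq_square)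
  qed
  have Vh: "E (\<lambda>i. (h i - c)\<^sup>2) = E (\<lambda>i. (h i)\<^sup>2) - c\<^sup>2"
  proof -
    have "E (\<lambda>i. (h i - c)\<^sup>2) = E (\<lambda>i. (h i)\<^sup>2 + c\<^sup>2 - (2 * c) * h i)"
      by (simp add: power2_diff mult.assoc mult.commute[of _ c])
    also have "\<dots> = E (\<lambda>i. (h i)\<^sup>2) + c\<^sup>2 - (2 * c) * c"
      using h by (simp add: integrable_pmf_intros c_def)
    finally show ?thesis
      by (simp add: power2_eq_square)
  qed
  have "E (\<lambda>i. h i - c) = 0"
    using h by (simp add: integrable_pmf_bounded c_def)
  then have V_le: "V \<le> exp (- 2 * \<gamma> * \<delta>) * (E (\<lambda>i. (h i)\<^sup>2) - c\<^sup>2)"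
    unfolding V_eq Vh[symmetric]
    using gap gamma d h by (intro spectral_decay) (auto intro: bfun)
  have V0: "0 \<le> V"
    unfolding V_eq by simp
  have Vh0: "0 \<le> E (\<lambda>i. (h i)\<^sup>2) - c\<^sup>2"
    unfolding Vh[symmetric] by simp
  have N0: "0 \<le> N"
    by (simp add: N_def)
  have N_le: "N \<le> E (\<lambda>i. (h i)\<^sup>2)"
    unfolding N_def w_def using d h by (intro E_S_square_le) auto
  have L0: "0 \<le> L"
    using gamma by (simp add: L_def)
  have fw: "\<theta> * E (\<lambda>i. f i * (w i)\<^sup>2) \<le> \<gamma> * V + L * N"
  proof -
    have "\<theta> * E (\<lambda>i. f i * (w i)\<^sup>2) \<le> \<theta> * (D * (sqrt N * sqrt V))"
      using expectation_times_square_le[of \<pi> f a b w] mean range w theta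
      by (intro mult_left_mono) (auto simp: D_def N_def V_def wc)
    also have "\<dots> \<le> \<gamma> * V + L * N"
    proof -
      \<comment> \<open>arithmetic-geometric mean inequality, with the weights that produce exactly \<open>\<gamma> * V\<close>\<close>
      have "0 \<le> (2 * \<gamma> * sqrt V - \<theta> * D * sqrt N)\<^sup>2 / (4 * \<gamma>)"
        using gamma by simp
      also have "(2 * \<gamma> * sqrt V - \<theta> * D * sqrt N)\<^sup>2
          = 4 * \<gamma>\<^sup>2 * V + \<theta>\<^sup>2 * D\<^sup>2 * N - 4 * \<gamma> * (\<theta> * (D * (sqrt N * sqrt V)))"
        using V0 N0 by (simp add: power2_diff power_mult_distrib algebra_simps)
      also have "\<dots> / (4 * \<gamma>) = \<gamma> * V + L * N - \<theta> * (D * (sqrt N * sqrt V))"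
        using gamma by (simp add: L_def field_simps power2_eq_square)
      finally show ?thesis by simp
    qed
    finally show ?thesis .
  qed
  define K where "K = 8 * \<delta>\<^sup>2 * \<theta>\<^sup>2 * D\<^sup>2"
  have K0: "0 \<le> K"
    by (simp add: K_def)
  have "E (\<lambda>i. (exp (\<delta> * \<theta> * f i) * w i)\<^sup>2) \<le> E (\<lambda>i. (1 + K) * (w i)\<^sup>2 + (2 * \<delta> * \<theta>) * (f i * (w i)\<^sup>2))"
  proof (intro integral_mono integrable_pmf_intros w f)
    show "bounded (range (\<lambda>i. exp (\<delta> * \<theta> * f i)))"
    proof -
      have "\<delta> * \<theta> * f i \<le> \<delta> * \<theta> * D" for i
        using absf[of i] d theta by (intro mult_left_mono) auto
      then show ?thesis by (auto simp: bounded_iff)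
    qed
    show "(exp (\<delta> * \<theta> * f i) * w i)\<^sup>2 \<le> (1 + K) * (w i)\<^sup>2 + (2 * \<delta> * \<theta>) * (f i * (w i)\<^sup>2)" for i
    proof -
      define x where "x = 2 * \<delta> * \<theta> * f i"
      have "\<bar>x\<bar> \<le> 2 * \<delta> * \<theta> * D"
        unfolding x_def abs_mult using d theta absf[of i] by (intro mult_mono) auto
      then have x: "x \<le> 1 / 2" "x\<^sup>2 \<le> (2 * \<delta> * \<theta> * D)\<^sup>2"
        using small power_mono[of "\<bar>x\<bar>" "2 * \<delta> * \<theta> * D" 2] by (auto simp: D_def)
      have "(exp (\<delta> * \<theta> * f i))\<^sup>2 = exp x"
        by (simp add: x_def power2_eq_square flip: exp_add)
      also have "\<dots> \<le> 1 + x + 2 * x\<^sup>2"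
        by (rule exp_le_quadratic[OF x(1)])
      also have "\<dots> \<le> 1 + K + 2 * \<delta> * \<theta> * f i"
        using x(2) by (simp add: K_def x_def power_mult_distrib)
      finally have "(exp (\<delta> * \<theta> * f i))\<^sup>2 * (w i)\<^sup>2 \<le> (1 + K + 2 * \<delta> * \<theta> * f i) * (w i)\<^sup>2"
        by (rule mult_right_mono) simp
      then show ?thesis
        by (simp add: power_mult_distrib algebra_simps)
    qed
  qed
  also have "\<dots> = (1 + K) * N + 2 * \<delta> * (\<theta> * E (\<lambda>i. f i * (w i)\<^sup>2))"
    using w f by (simp add: integrable_pmf_intros N_def)
  also have "\<dots> \<le> (1 + K) * N + 2 * \<delta> * (\<gamma> * V + L * N)"
    using fw d by (intro add_left_mono mult_left_mono) auto
  also have "\<dots> = c\<^sup>2 + (1 + 2 * \<gamma> * \<delta>) * V + (2 * \<delta> * L + K) * N"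
    by (simp add: V_def algebra_simps)
  also have "\<dots> \<le> c\<^sup>2 + (E (\<lambda>i. (h i)\<^sup>2) - c\<^sup>2) + (2 * \<delta> * L + K) * E (\<lambda>i. (h i)\<^sup>2)"
  proof (intro add_mono mult_left_mono order_refl N_le)
    have "(1 + 2 * \<gamma> * \<delta>) * V \<le> exp (2 * \<gamma> * \<delta>) * (exp (- 2 * \<gamma> * \<delta>) * (E (\<lambda>i. (h i)\<^sup>2) - c\<^sup>2))"
      using V_le V0 by (intro mult_mono) auto
    also have "\<dots> = E (\<lambda>i. (h i)\<^sup>2) - c\<^sup>2"
      by (simp add: exp_minus)
    finally show "(1 + 2 * \<gamma> * \<delta>) * V \<le> E (\<lambda>i. (h i)\<^sup>2) - c\<^sup>2" .
    show "0 \<le> 2 * \<delta> * L + K"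
      using d L0 K0 by simp
  qed
  also have "\<dots> = (1 + (2 * \<delta> * L + K)) * E (\<lambda>i. (h i)\<^sup>2)"
    by (simp add: algebra_simps)
  also have "\<dots> \<le> exp (2 * \<delta> * L + K) * E (\<lambda>i. (h i)\<^sup>2)"
    by (intro mult_right_mono exp_ge_add_one_self) auto
  finally show ?thesis
    by (simp add: L_def K_def D_def w_def)
qed

text \<open>
  A discrete Feynman-Kac functional: started in \<open>i\<close>, the expectation of the product of \<open>\<phi>\<close>
  over the states at the times \<open>0, \<delta>, \<dots>, n \<delta>\<close>; see \<open>nn_integral_skeleton\<close>.
\<close>

primrec tilted_iter :: "real \<Rightarrow> ('e \<Rightarrow> real) \<Rightarrow> nat \<Rightarrow> 'e \<Rightarrow> real" where
  "tilted_iter \<delta> \<phi> 0 = \<phi>"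
| "tilted_iter \<delta> \<phi> (Suc n) = (\<lambda>i. \<phi> i * S \<delta> (tilted_iter \<delta> \<phi> n) i)"

lemma bounded_tilted_iter: "bounded (range \<phi>) \<Longrightarrow> bounded (range (tilted_iter \<delta> \<phi> n))"
  by (induction n) (simp_all add: bounded_mult_real bounded_S)

lemma S_nonneg: "(\<And>i. 0 \<le> f i) \<Longrightarrow> 0 \<le> S t f i"
  by (simp add: semigroup_op_def)

lemma tilted_iter_nonneg: "(\<And>i. 0 \<le> \<phi> i) \<Longrightarrow> 0 \<le> tilted_iter \<delta> \<phi> n i"
  by (induction n arbitrary: i) (simp_all add: S_nonneg)

text \<open>
  The term \<open>\<theta> * b\<close> accounts for the factor at time \<open>0\<close>, which is one more factor than there are steps.
\<close>

lemma E_tilted_iter_le: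
  assumes gap: "ereal \<gamma> \<le> spectral_gap \<pi> P" and gamma: "0 < \<gamma>"
    and mean: "E f = 0" and range: "\<And>i. a \<le> f i" "\<And>i. f i \<le> b"
    and theta: "0 \<le> \<theta>" and d: "0 < \<delta>" and small: "2 * \<delta> * \<theta> * (b - a) \<le> 1 / 2"
  shows "E (tilted_iter \<delta> (\<lambda>i. exp (\<delta> * \<theta> * f i)) n)
    \<le> exp (real n * \<delta> * (\<theta>\<^sup>2 * (b - a)\<^sup>2 / (4 * \<gamma>)) + \<delta> * (4 * (real n * \<delta>) * \<theta>\<^sup>2 * (b - a)\<^sup>2 + \<theta> * b))"
proof -
  define \<phi> where "\<phi> i = exp (\<delta> * \<theta> * f i)" for i
  define q where "q = 2 * \<delta> * (\<theta>\<^sup>2 * (b - a)\<^sup>2 / (4 * \<gamma>)) + 8 * \<delta>\<^sup>2 * \<theta>\<^sup>2 * (b - a)\<^sup>2"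
  have phi: "\<phi> i \<le> exp (\<delta> * \<theta> * b)" for i
    using range d theta by (simp add: \<phi>_def mult_left_mono)
  then have b\<phi>: "bounded (range \<phi>)"
    by (auto simp: bounded_iff \<phi>_def)
  have "E (\<lambda>i. (tilted_iter \<delta> \<phi> n i)\<^sup>2) \<le> exp q ^ n * (exp (\<delta> * \<theta> * b))\<^sup>2"
  proof (induction n)
    case 0
    have "E (\<lambda>i. (\<phi> i)\<^sup>2) \<le> E (\<lambda>i. (exp (\<delta> * \<theta> * b))\<^sup>2)"
      using phi by (intro integral_mono integrable_pmf_intros b\<phi> power_mono) (auto simp: \<phi>_def)
    then show ?case by simp
  next
    case (Suc n)
    have "E (\<lambda>i. (tilted_iter \<delta> \<phi> (Suc n) i)\<^sup>2) \<le> exp q * E (\<lambda>i. (tilted_iter \<delta> \<phi> n i)\<^sup>2)"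
      using tilted_step_le[OF gap gamma mean range theta d small bounded_tilted_iter[OF b\<phi>]]
      by (simp add: \<phi>_def q_def)
    also have "\<dots> \<le> exp q * (exp q ^ n * (exp (\<delta> * \<theta> * b))\<^sup>2)"
      using Suc.IH by (intro mult_left_mono) auto
    finally show ?case
      by (simp add: mult.assoc)
  qed
  also have "exp q ^ n * (exp (\<delta> * \<theta> * b))\<^sup>2 = exp (real n * q + 2 * (\<delta> * \<theta> * b))"
    by (simp add: exp_add exp_of_nat_mult exp_double)
  also have "\<dots> = (exp (real n * \<delta> * (\<theta>\<^sup>2 * (b - a)\<^sup>2 / (4 * \<gamma>)) + \<delta> * (4 * (real n * \<delta>) * \<theta>\<^sup>2 * (b - a)\<^sup>2 + \<theta> * b)))\<^sup>2"
    by (simp add: exp_double[symmetric] q_def) (simp add: algebra_simps power2_eq_square)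
  finally have "E (\<lambda>i. (tilted_iter \<delta> \<phi> n i)\<^sup>2) \<le> \<dots>" .
  then have "(E (tilted_iter \<delta> \<phi> n))\<^sup>2 \<le> (exp (real n * \<delta> * (\<theta>\<^sup>2 * (b - a)\<^sup>2 / (4 * \<gamma>)) + \<delta> * (4 * (real n * \<delta>) * \<theta>\<^sup>2 * (b - a)\<^sup>2 + \<theta> * b)))\<^sup>2"
    using expectation_pmf_square_le[OF bounded_tilted_iter[OF b\<phi>], of \<pi> \<delta> n] by linarith
  then show ?thesis
    unfolding \<phi>_def[abs_def] by (rule power2_le_imp_le) simp
qed

end

section \<open>The chain observed at equidistant times\<close>

text \<open>
  The law of the states at the times \<open>0, \<delta>, \<dots>, n \<delta>\<close> of the chain started in \<open>i\<close>. Lists over a countable type form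
  a countable type, so that laws of such observations are determined by the probabilities of
  single lists, which is what the definition of a Markov chain prescribes.
\<close>

primrec skeleton_pmf :: "(real \<Rightarrow> 'e \<Rightarrow> 'e pmf) \<Rightarrow> real \<Rightarrow> nat \<Rightarrow> 'e \<Rightarrow> 'e list pmf" where
  "skeleton_pmf P \<delta> 0 i = return_pmf [i]"
| "skeleton_pmf P \<delta> (Suc n) i = bind_pmf (P \<delta> i) (\<lambda>j. map_pmf ((#) i) (skeleton_pmf P \<delta> n j))"

lemma pmf_skeleton:
  "pmf (skeleton_pmf P \<delta> n i) xs
    = (if length xs = Suc n \<and> xs ! 0 = i then \<Prod>k<n. pmf (P \<delta> (xs ! k)) (xs ! Suc k) else 0)"
proof (induction n arbitrary: i xs)
  case 0
  show ?case
    by (cases xs) (auto simp: pmf_return split: if_splits)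
next
  case (Suc n)
  show ?case
  proof (cases "\<exists>ys. xs = i # ys")
    case False
    have "pmf (map_pmf ((#) i) (skeleton_pmf P \<delta> n j)) xs = 0" for j
      using False by (intro pmf_map_outside) auto
    moreover have "\<not> (length xs = Suc (Suc n) \<and> xs ! 0 = i)"
      using False by (cases xs) auto
    ultimately show ?thesis
      by (auto simp: pmf_bind)
  next
    case True
    then obtain ys where xs: "xs = i # ys" by auto
    define R where "R = (if length ys = Suc n then \<Prod>k<n. pmf (P \<delta> (ys ! k)) (ys ! Suc k) else 0)"
    have "pmf (skeleton_pmf P \<delta> (Suc n) i) xs
        = measure_pmf.expectation (P \<delta> i) (\<lambda>j. pmf (skeleton_pmf P \<delta> n j) ys)"
      by (simp add: pmf_bind xs pmf_map_inj')
    also have "\<dots> = measure_pmf.expectation (P \<delta> i) (\<lambda>j. if ys ! 0 = j then R else 0)"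
    proof -
      have "pmf (skeleton_pmf P \<delta> n j) ys = (if ys ! 0 = j then R else 0)" for j
        by (simp add: Suc.IH R_def)
      then show ?thesis by simp
    qed
    also have "\<dots> = R * pmf (P \<delta> i) (ys ! 0)"
      by (subst integral_measure_pmf_real[where A = "{ys ! 0}"]) (auto split: if_splits)
    also have "\<dots> = (if length xs = Suc (Suc n) \<and> xs ! 0 = i then \<Prod>k<Suc n. pmf (P \<delta> (xs ! k)) (xs ! Suc k) else 0)"
      by (simp add: xs R_def prod.lessThan_Suc_shift mult.commute del: prod.lessThan_Suc)
    finally show ?thesis .
  qed
qed

lemma distr_skeleton:
  fixes X :: "real \<Rightarrow> 'w \<Rightarrow> 'e :: countable"
  assumes mc: "markov_chain M X \<mu> P" and d: "0 < \<delta>"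
  shows "(\<lambda>\<omega>. map (\<lambda>k. X (real k * \<delta>) \<omega>) [0..<Suc n]) \<in> measurable M (count_space UNIV)"
    and "distr M (count_space UNIV) (\<lambda>\<omega>. map (\<lambda>k. X (real k * \<delta>) \<omega>) [0..<Suc n])
      = measure_pmf (bind_pmf \<mu> (skeleton_pmf P \<delta> n))"
proof -
  interpret prob_space M
    using mc by (simp add: markov_chain_def)
  let ?Y = "\<lambda>\<omega>. map (\<lambda>k. X (real k * \<delta>) \<omega>) [0..<Suc n]"
  have X: "X t \<in> measurable M (count_space UNIV)" if "0 \<le> t" for t
    using mc that by (simp add: markov_chain_def)
  have Y_eq: "?Y \<omega> = xs \<longleftrightarrow> length xs = Suc n \<and> (\<forall>k\<le>n. X (real k * \<delta>) \<omega> = xs ! k)" for \<omega> xs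
  proof -
    have "?Y \<omega> = xs \<longleftrightarrow> length xs = Suc n \<and> (\<forall>k<Suc n. ?Y \<omega> ! k = xs ! k)"
      unfolding list_eq_iff_nth_eq length_map length_upt by auto
    also have "(\<forall>k<Suc n. ?Y \<omega> ! k = xs ! k) \<longleftrightarrow> (\<forall>k<Suc n. X (real k * \<delta>) \<omega> = xs ! k)"
      by (simp add: nth_map_upt del: upt_Suc)
    finally show ?thesis
      by (simp only: less_Suc_eq_le)
  qed
  have pre: "?Y -` {xs} \<inter> space M
      = (if length xs = Suc n then {\<omega> \<in> space M. \<forall>k\<le>n. X (real k * \<delta>) \<omega> = xs ! k} else {})" for xs
    unfolding vimage_def Int_def mem_Collect_eq singleton_iff Y_eq by auto
  have ev: "{\<omega> \<in> space M. \<forall>k\<le>n. X (real k * \<delta>) \<omega> = xs ! k} \<in> sets M" for xs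
  proof -
    have "{\<omega> \<in> space M. X (real k * \<delta>) \<omega> = xs ! k} \<in> sets M" for k
      using measurable_sets[OF X[of "real k * \<delta>"], of "{xs ! k}"] d
      unfolding vimage_def Int_def singleton_iff mem_Collect_eq by (simp add: conj_commute[of _ "_ \<in> space M"])
    then have "(\<Inter>k\<in>{..n}. {\<omega> \<in> space M. X (real k * \<delta>) \<omega> = xs ! k}) \<in> sets M"
      by (intro sets.finite_INT) auto
    also have "(\<Inter>k\<in>{..n}. {\<omega> \<in> space M. X (real k * \<delta>) \<omega> = xs ! k})
        = {\<omega> \<in> space M. \<forall>k\<le>n. X (real k * \<delta>) \<omega> = xs ! k}"
      by auto
    finally show ?thesis .
  qed
  have Y: "?Y \<in> measurable M (count_space UNIV)"
  proof (rule measurable_count_space_eq2_countable[THEN iffD2], rule conjI)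
    show "?Y \<in> space M \<rightarrow> UNIV"
      by simp
    show "\<forall>xs\<in>UNIV. ?Y -` {xs} \<inter> space M \<in> sets M"
    proof
      fix xs :: "'e list"
      show "?Y -` {xs} \<inter> space M \<in> sets M"
        by (subst pre, cases "length xs = Suc n") (simp_all only: if_True if_False ev sets.empty_sets simp_thms)
    qed
  qed
  have distr: "distr M (count_space UNIV) ?Y = measure_pmf (bind_pmf \<mu> (skeleton_pmf P \<delta> n))"
  proof (rule measure_eqI_countable[where A = UNIV])
    fix xs :: "'e list"
    have "measure M (?Y -` {xs} \<inter> space M) = pmf (bind_pmf \<mu> (skeleton_pmf P \<delta> n)) xs"
    proof (cases "length xs = Suc n")
      case True
      define t where "t k = real k * \<delta>" for k
      have "\<forall>n t i. t 0 = 0 \<and> (\<forall>k<n. t k < t (Suc k)) \<longrightarrow>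
          measure M {\<omega> \<in> space M. \<forall>k\<le>n. X (t k) \<omega> = i k} =
          pmf \<mu> (i 0) * (\<Prod>k<n. pmf (P (t (Suc k) - t k) (i k)) (i (Suc k)))"
        using mc unfolding markov_chain_def by blast
      moreover have "t 0 = 0 \<and> (\<forall>k<n. t k < t (Suc k))"
        using d by (auto simp: t_def)
      ultimately have "measure M {\<omega> \<in> space M. \<forall>k\<le>n. X (t k) \<omega> = xs ! k} =
          pmf \<mu> (xs ! 0) * (\<Prod>k<n. pmf (P (t (Suc k) - t k) (xs ! k)) (xs ! Suc k))"
        by blast
      also have "\<dots> = pmf \<mu> (xs ! 0) * (\<Prod>k<n. pmf (P \<delta> (xs ! k)) (xs ! Suc k))"
        by (simp add: t_def algebra_simps)
      also have "\<dots> = pmf (bind_pmf \<mu> (skeleton_pmf P \<delta> n)) xs"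
        unfolding pmf_bind pmf_skeleton
        by (subst integral_measure_pmf_real[where A = "{xs ! 0}"]) (auto simp: True split: if_splits)
      finally show ?thesis
        using True by (simp add: pre t_def del: upt_Suc)
    next
      case False
      then show ?thesis
        by (simp add: pre pmf_bind pmf_skeleton del: upt_Suc)
    qed
    then show "emeasure (distr M (count_space UNIV) ?Y) {xs}
        = emeasure (measure_pmf (bind_pmf \<mu> (skeleton_pmf P \<delta> n))) {xs}"
      by (subst emeasure_distr[OF Y]) (simp_all add: emeasure_eq_measure emeasure_pmf_single del: upt_Suc)
  qed auto
  show "?Y \<in> measurable M (count_space UNIV)"
    by (fact Y)
  show "distr M (count_space UNIV) ?Y = measure_pmf (bind_pmf \<mu> (skeleton_pmf P \<delta> n))"
    by (fact distr)
qed

lemma prod_list_map_upt: "prod_list (map g [0..<n]) = (\<Prod>k<n. g k :: real)"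
  by (induction n) auto

context stationary_semigroup
begin

lemma nn_integral_skeleton:
  assumes "bounded (range \<phi>)" and nn: "\<And>i. 0 \<le> \<phi> i"
  shows "(\<integral>\<^sup>+xs. ennreal (prod_list (map \<phi> xs)) \<partial>measure_pmf (skeleton_pmf P \<delta> n i))
    = ennreal (tilted_iter \<delta> \<phi> n i)"
proof (induction n arbitrary: i)
  case (Suc n)
  have "(\<integral>\<^sup>+xs. ennreal (prod_list (map \<phi> xs)) \<partial>measure_pmf (skeleton_pmf P \<delta> (Suc n) i))
      = (\<integral>\<^sup>+j. ennreal (\<phi> i) * ennreal (tilted_iter \<delta> \<phi> n j) \<partial>measure_pmf (P \<delta> i))"
    by (simp add: ennreal_mult' nn nn_integral_cmult Suc.IH)
  also have "\<dots> = ennreal (\<phi> i) * ennreal (S \<delta> (tilted_iter \<delta> \<phi> n) i)"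
    unfolding semigroup_op_def
    by (subst nn_integral_cmult, simp, subst nn_integral_eq_integral)
      (auto intro: integrable_pmf_bounded bounded_tilted_iter assms tilted_iter_nonneg)
  finally show ?case
    by (simp add: ennreal_mult' nn)
qed simp

lemma nn_integral_exp_sum:
  fixes X :: "real \<Rightarrow> 'w \<Rightarrow> 'e"
  assumes mc: "markov_chain M X \<pi> P" and d: "0 < \<delta>" and f: "\<And>i. f i \<le> b"
    and theta: "0 \<le> \<theta>"
  shows "(\<integral>\<^sup>+\<omega>. ennreal (exp (\<theta> * (\<delta> * (\<Sum>k<Suc n. f (X (real k * \<delta>) \<omega>))))) \<partial>M)
    = ennreal (E (tilted_iter \<delta> (\<lambda>i. exp (\<delta> * \<theta> * f i)) n))"
proof -
  define \<phi> where "\<phi> i = exp (\<delta> * \<theta> * f i)" for i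
  have "\<phi> i \<le> exp (\<delta> * \<theta> * b)" for i
    using f d theta by (simp add: \<phi>_def mult_left_mono)
  then have b\<phi>: "bounded (range \<phi>)"
    by (auto simp: bounded_iff \<phi>_def)
  have nn: "0 \<le> \<phi> i" for i
    by (simp add: \<phi>_def)
  let ?Y = "\<lambda>\<omega>. map (\<lambda>k. X (real k * \<delta>) \<omega>) [0..<Suc n]"
  have "exp (\<theta> * (\<delta> * (\<Sum>k<Suc n. f (X (real k * \<delta>) \<omega>)))) = prod_list (map \<phi> (?Y \<omega>))" for \<omega>
  proof -
    have "prod_list (map \<phi> (?Y \<omega>)) = (\<Prod>k<Suc n. \<phi> (X (real k * \<delta>) \<omega>))"
      unfolding map_map prod_list_map_upt by (simp add: o_def)
    also have "\<dots> = exp (\<Sum>k<Suc n. \<delta> * \<theta> * f (X (real k * \<delta>) \<omega>))"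
      by (simp only: \<phi>_def exp_sum[OF finite_lessThan])
    finally show ?thesis
      by (simp add: sum_distrib_left mult.assoc mult.left_commute del: sum.lessThan_Suc)
  qed
  then have "(\<integral>\<^sup>+\<omega>. ennreal (exp (\<theta> * (\<delta> * (\<Sum>k<Suc n. f (X (real k * \<delta>) \<omega>))))) \<partial>M)
      = (\<integral>\<^sup>+\<omega>. ennreal (prod_list (map \<phi> (?Y \<omega>))) \<partial>M)"
    by simp
  also have "\<dots> = (\<integral>\<^sup>+xs. ennreal (prod_list (map \<phi> xs)) \<partial>distr M (count_space UNIV) ?Y)"
    by (rule nn_integral_distr[OF distr_skeleton(1)[OF mc d], symmetric]) simp
  also have "\<dots> = (\<integral>\<^sup>+i. ennreal (tilted_iter \<delta> \<phi> n i) \<partial>measure_pmf \<pi>)"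
    unfolding distr_skeleton(2)[OF mc d] by (simp add: nn_integral_skeleton[OF b\<phi> nn])
  also have "\<dots> = ennreal (E (tilted_iter \<delta> \<phi> n))"
    by (intro nn_integral_eq_integral)
      (auto intro: integrable_pmf_bounded bounded_tilted_iter b\<phi> nn tilted_iter_nonneg)
  finally show ?thesis
    by (simp add: \<phi>_def[abs_def])
qed

end

text \<open>
  Sampling each cell at its right end point, the step function at \<open>s\<close> takes the value of the path at a time in
  \<open>{s..<s + \<delta> n}\<close>, hence eventually the value at \<open>s\<close>. Right-continuity is therefore enough, and
  the summand \<open>k = 0\<close> is an additional term that vanishes in the limit.
\<close>

lemma riemann_sum_right_continuous:
  fixes x :: "real \<Rightarrow> 'e" and g :: "'e \<Rightarrow> real"
  assumes x: "\<And>s. 0 \<le> s \<Longrightarrow> eventually (\<lambda>u. x u = x s) (at_right s)"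
    and g: "\<And>i. \<bar>g i\<bar> \<le> B" and t: "0 < t"
  defines "\<delta> \<equiv> \<lambda>n. t / real (Suc n)"
  shows "set_integrable lborel {0..t} (\<lambda>s. g (x s))"
    and "(\<lambda>n. \<delta> n * (\<Sum>k<Suc (Suc n). g (x (real k * \<delta> n)))) \<longlonglongrightarrow> (LBINT s:{0..t}. g (x s))"
proof -
  define cell where "cell n k = {(real k - 1) * \<delta> n <.. real k * \<delta> n}" for n k
  \<comment> \<open>the summand at \<open>0\<close>, which no cell covers, makes the convergence hold at every point, so that measurability of
    the limit comes for free\<close>
  define step where "step n s = indicator {0} s * g (x 0)
      + (\<Sum>k=1..Suc n. indicator (cell n k) s * g (x (real k * \<delta> n)))" for n s
  have d: "0 < \<delta> n" "real (Suc n) * \<delta> n = t" for n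
    using t by (auto simp: \<delta>_def)
  have step_eq: "\<exists>u. step n s = indicator {0..t} s * g (x u) \<and> s \<le> u \<and> u < s + \<delta> n" for n s
  proof -
    consider "s = 0" | "0 < s" "s \<le> t" | "s < 0 \<or> s > t" by linarith
    then show ?thesis
    proof cases
      case 1
      have "indicator (cell n k) s * g (x (real k * \<delta> n)) = 0" if "k \<in> {1..Suc n}" for k
        using that 1 d[of n] by (auto simp: cell_def indicator_def mult_less_0_iff)
      then have "(\<Sum>k=1..Suc n. indicator (cell n k) s * g (x (real k * \<delta> n))) = 0"
        by (intro sum.neutral ballI)
      then have "step n s = indicator {0} s * g (x 0)"
        unfolding step_def by (simp only: add_0_right)
      then show ?thesis
        using 1 t d[of n] by (intro exI[of _ 0]) auto
    next
      case 2
      define m where "m = nat \<lceil>s / \<delta> n\<rceil>"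
      have "0 < s / \<delta> n"
        using 2 d[of n] by simp
      then have m: "1 \<le> m" "real m - 1 < s / \<delta> n" "s / \<delta> n \<le> real m"
        unfolding m_def by linarith+
      have uniq: "s \<in> cell n k \<longleftrightarrow> k = m" if "k \<in> {1..Suc n}" for k
      proof
        assume "s \<in> cell n k"
        then have "real k - 1 < s / \<delta> n" "s / \<delta> n \<le> real k"
          using d[of n] by (auto simp: cell_def field_simps)
        then show "k = m"
          using m by linarith
      next
        assume "k = m"
        then show "s \<in> cell n k"
          using m d[of n] by (auto simp: cell_def field_simps)
      qed
      have "s / \<delta> n \<le> real (Suc n)"
        using 2 d[of n] by (simp add: field_simps)
      then have "m \<in> {1..Suc n}"
        using m by auto
      have "step n s = (\<Sum>k=1..Suc n. if k = m then g (x (real k * \<delta> n)) else 0)"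
      proof -
        have "(\<Sum>k=1..Suc n. indicator (cell n k) s * g (x (real k * \<delta> n)))
            = (\<Sum>k=1..Suc n. if k = m then g (x (real k * \<delta> n)) else 0)"
          by (rule sum.cong[OF refl]) (simp only: uniq indicator_def, simp)
        then show ?thesis
          unfolding step_def using 2 by (simp del: sum.cl_ivl_Suc)
      qed
      also have "\<dots> = g (x (real m * \<delta> n))"
        using \<open>m \<in> {1..Suc n}\<close> by (simp del: sum.cl_ivl_Suc)
      finally have "step n s = indicator {0..t} s * g (x (real m * \<delta> n))"
        using 2 by simp
      moreover have "s \<le> real m * \<delta> n" "real m * \<delta> n < s + \<delta> n"
        using m d[of n] by (auto simp: field_simps)
      ultimately show ?thesis by blast
    next
      case 3
      have "indicator (cell n k) s * g (x (real k * \<delta> n)) = 0" if "k \<in> {1..Suc n}" for k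
      proof -
        have "0 \<le> (real k - 1) * \<delta> n" "real k * \<delta> n \<le> real (Suc n) * \<delta> n"
          using that d(1)[of n] by (auto intro!: mult_nonneg_nonneg mult_right_mono)
        then have "s \<notin> cell n k"
          using 3 d(2)[of n] by (auto simp: cell_def)
        then show ?thesis by simp
      qed
      then have "(\<Sum>k=1..Suc n. indicator (cell n k) s * g (x (real k * \<delta> n))) = 0"
        by (intro sum.neutral ballI)
      moreover have "s \<noteq> 0"
        using 3 t by auto
      ultimately have "step n s = 0"
        unfolding step_def by (simp del: sum.cl_ivl_Suc)
      moreover have "s \<notin> {0..t}"
        using 3 by auto
      ultimately show ?thesis
        using d(1)[of n] by (intro exI[of _ s]) simp
    qed
  qed
  have dlim: "\<delta> \<longlonglongrightarrow> 0"
    unfolding \<delta>_def by (rule LIMSEQ_Suc, rule lim_const_over_n)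
  have lim: "(\<lambda>n. step n s) \<longlonglongrightarrow> indicator {0..t} s * g (x s)" for s
  proof (cases "s \<in> {0..t}")
    case True
    then obtain e where e: "e > s" "\<And>u. s < u \<Longrightarrow> u < e \<Longrightarrow> x u = x s"
      using x[of s] by (auto simp: eventually_at_right_field)
    have "eventually (\<lambda>n. \<delta> n < e - s) sequentially"
      using dlim e by (intro order_tendstoD(2)) auto
    then have "eventually (\<lambda>n. step n s = indicator {0..t} s * g (x s)) sequentially"
    proof eventually_elim
      case (elim n)
      obtain u where "step n s = indicator {0..t} s * g (x u)" "s \<le> u" "u < s + \<delta> n"
        using step_eq by blast
      then show ?case
        using elim e(2)[of u] by (cases "u = s") auto
    qed
    then show ?thesis
      by (rule tendsto_eventually)
  next
    case False
    then have "step n s = 0" for n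
      using step_eq[of n s] by auto
    then show ?thesis using False by simp
  qed
  have step_meas: "step n \<in> borel_measurable lborel" for n
    unfolding step_def[abs_def] cell_def by measurable
  have meas: "(\<lambda>s. indicator {0..t} s * g (x s)) \<in> borel_measurable lborel"
    by (rule borel_measurable_LIMSEQ_real[OF lim step_meas])
  have bnd: "integrable lborel (\<lambda>s. indicator {0..t} s * B)"
    using t by (intro integrable_mult_left) (auto simp: integrable_indicator_iff)
  have B: "\<bar>indicator {0..t} s * g i\<bar> \<le> indicator {0..t} s * B" for s i
    using g by (auto simp: indicator_def)
  show "set_integrable lborel {0..t} (\<lambda>s. g (x s))"
    unfolding set_integrable_def using meas B
    by (intro Bochner_Integration.integrable_bound[OF bnd]) (auto intro!: always_eventually order_trans[OF B])
  have "(\<lambda>n. \<integral>s. step n s \<partial>lborel) \<longlonglongrightarrow> (\<integral>s. indicator {0..t} s * g (x s) \<partial>lborel)"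
  proof (rule integral_dominated_convergence[OF meas step_meas bnd])
    show "AE s in lborel. norm (step n s) \<le> indicator {0..t} s * B" for n
      using step_eq[of n] B by (intro always_eventually allI) (metis real_norm_def)
  qed (use lim in auto)
  moreover have "(\<integral>s. step n s \<partial>lborel) = \<delta> n * (\<Sum>k=1..Suc n. g (x (real k * \<delta> n)))" for n
  proof -
    have c: "has_bochner_integral lborel (\<lambda>s. indicator (cell n k) s * v) (\<delta> n * v)" for k and v :: real
    proof (rule has_bochner_integral_mult_left)
      have le: "(real k - 1) * \<delta> n \<le> real k * \<delta> n"
        using d(1)[of n] by (intro mult_right_mono) auto
      then have "measure lborel (cell n k) = \<delta> n"
        by (simp add: cell_def algebra_simps)
      moreover have "has_bochner_integral lborel (indicator (cell n k)) (measure lborel (cell n k))"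
        using le by (intro has_bochner_integral_real_indicator) (simp_all add: cell_def)
      ultimately show "has_bochner_integral lborel (indicator (cell n k)) (\<delta> n)"
        by simp
    qed
    have z: "has_bochner_integral lborel (\<lambda>s. indicator {0} s * v) (0 * v)" for v :: real
      by (rule has_bochner_integral_mult_left) (simp add: has_bochner_integral_iff integrable_indicator_iff)
    have "has_bochner_integral lborel (step n) (0 * g (x 0) + (\<Sum>k=1..Suc n. \<delta> n * g (x (real k * \<delta> n))))"
      unfolding step_def by (intro has_bochner_integral_add has_bochner_integral_sum c z)
    then show ?thesis
      by (simp only: has_bochner_integral_iff sum_distrib_left mult_zero_left add_0)
  qed
  ultimately have "(\<lambda>n. \<delta> n * g (x 0) + \<delta> n * (\<Sum>k=1..Suc n. g (x (real k * \<delta> n))))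
      \<longlonglongrightarrow> 0 * g (x 0) + (\<integral>s. indicator {0..t} s * g (x s) \<partial>lborel)"
    by (intro tendsto_intros dlim) simp
  moreover have "\<delta> n * g (x 0) + \<delta> n * (\<Sum>k=1..Suc n. g (x (real k * \<delta> n)))
      = \<delta> n * (\<Sum>k<Suc (Suc n). g (x (real k * \<delta> n)))" for n
    by (simp only: sum.lessThan_Suc_shift[of _ "Suc n"] sum.atLeast_Suc_atMost_Suc_shift
        One_nat_def atLeast0AtMost lessThan_Suc_atMost[symmetric] o_def) (simp add: distrib_left)
  ultimately show "(\<lambda>n. \<delta> n * (\<Sum>k<Suc (Suc n). g (x (real k * \<delta> n)))) \<longlonglongrightarrow> (LBINT s:{0..t}. g (x s))"
    by (simp add: set_lebesgue_integral_def del: sum.lessThan_Suc)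
qed

section \<open>The tail bound for time averages\<close>

text \<open>
  Existence of the derivative at \<open>0\<close> makes the transition function standard, and an irreducible chain
  carries the mass of its invariant distribution into every state.
\<close>

lemma stationary_semigroup_q_process:
  fixes P :: "real \<Rightarrow> 'e :: countable \<Rightarrow> 'e pmf"
  assumes q: "q_transition Q P" and irr: "irreducible_chain P" and inv: "invariant_distr P \<pi>"
  shows "stationary_semigroup P \<pi>"
proof
  show "P 0 i = return_pmf i" for i
    using q by (simp add: q_transition_def)
  show "P (s + t) i = bind_pmf (P s i) (P t)" if "0 \<le> s" "0 \<le> t" for s t i
    using q that by (simp add: q_transition_def)
  show inv': "bind_pmf \<pi> (P t) = \<pi>" if "0 \<le> t" for t
    using inv that by (simp add: invariant_distr_def)
  show "((\<lambda>t. pmf (P t i) i) \<longlongrightarrow> 1) (at_right 0)" for i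
  proof -
    have "((\<lambda>t. (pmf (P t i) i - of_bool (i = i)) / t) \<longlongrightarrow> Q i i) (at_right 0)"
      using q unfolding q_transition_def by blast
    then have "((\<lambda>t. t * ((pmf (P t i) i - 1) / t)) \<longlongrightarrow> 0 * Q i i) (at_right 0)"
      by (intro tendsto_mult tendsto_ident_at) simp
    then have "((\<lambda>t. pmf (P t i) i - 1) \<longlongrightarrow> 0 * Q i i) (at_right 0)"
      by (rule Lim_transform_eventually) (simp add: eventually_at_filter)
    then show ?thesis
      by (simp add: LIM_zero_iff)
  qed
  show "0 < pmf \<pi> j" for j
  proof -
    obtain i where i: "i \<in> set_pmf \<pi>"
      using set_pmf_not_empty[of \<pi>] by auto
    obtain t where t: "t > 0" "0 < pmf (P t i) j"
      using irr by (auto simp: irreducible_chain_def)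
    then have "j \<in> set_pmf (P t i)"
      by (simp add: pmf_positive_iff)
    then have "j \<in> set_pmf (bind_pmf \<pi> (P t))"
      using i by auto
    then show ?thesis
      using inv'[of t] t by (simp add: pmf_positive_iff)
  qed
qed

context stationary_semigroup
begin

text \<open>
  The exponential moment of the time integral is the limit of those of the Riemann sums. The sum
  with \<open>Suc n\<close> steps has \<open>Suc (Suc n)\<close> summands and corresponds to \<open>Suc n\<close> iterations of the tilted operator.
\<close>

theorem hoeffding_time_integral:
  fixes X :: "real \<Rightarrow> 'w \<Rightarrow> 'e"
  assumes mc: "markov_chain M X \<pi> P"
    and gap: "ereal \<gamma> \<le> spectral_gap \<pi> P" and gamma: "0 < \<gamma>"
    and ab: "a < b" and g: "\<And>i. a \<le> g i" "\<And>i. g i \<le> b"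
    and t: "0 < t" and eps: "0 < \<epsilon>"
  shows "measure M {\<omega> \<in> space M. (1 / t) * (LBINT s:{0..t}. g (X s \<omega>)) - E g \<ge> \<epsilon>}
    \<le> exp (- (\<gamma> * t * \<epsilon>\<^sup>2 / (b - a)\<^sup>2))"
proof -
  interpret prob_space M
    using mc by (simp add: markov_chain_def)
  define f where "f i = g i - E g" for i
  \<comment> \<open>the minimiser of \<open>\<theta>\<^sup>2 (b - a)\<^sup>2 / (4 \<gamma>) - \<theta> \<epsilon>\<close>\<close>
  define \<theta> where "\<theta> = 2 * \<gamma> * \<epsilon> / (b - a)\<^sup>2"
  define L where "L = \<theta>\<^sup>2 * (b - a)\<^sup>2 / (4 * \<gamma>)"
  define \<delta> where "\<delta> n = t / real (Suc n)" for n
  define I where "I \<omega> = (LBINT s:{0..t}. f (X s \<omega>))" for \<omega>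
  define R where "R n \<omega> = \<delta> n * (\<Sum>k<Suc (Suc n). f (X (real k * \<delta> n) \<omega>))" for n \<omega>
  have D: "0 < b - a" using ab by simp
  have theta: "0 < \<theta>"
    using gamma eps D by (simp add: \<theta>_def)
  have gB: "\<bar>g i\<bar> \<le> \<bar>a\<bar> + \<bar>b\<bar>" for i
    using g(1)[of i] g(2)[of i] by linarith
  have bg: "bounded (range g)"
    using gB by (auto simp: bounded_iff)
  have f: "a - E g \<le> f i" "f i \<le> b - E g" for i
    using g by (auto simp: f_def)
  have mean: "E f = 0"
    by (simp add: f_def[abs_def] integrable_pmf_bounded bg)
  define B where "B = \<bar>a - E g\<bar> + \<bar>b - E g\<bar>"
  have B: "\<bar>f i\<bar> \<le> B" for i
    using f[of i] by (auto simp: B_def)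
  have d: "0 < \<delta> n" "real (Suc n) * \<delta> n = t" for n
    using t by (auto simp: \<delta>_def)
  have dlim: "\<delta> \<longlonglongrightarrow> 0"
    unfolding \<delta>_def[abs_def] by (rule LIMSEQ_Suc, rule lim_const_over_n)
  have X[measurable]: "X s \<in> measurable M (count_space UNIV)" if "0 \<le> s" for s
    using mc that by (simp add: markov_chain_def)
  have path: "eventually (\<lambda>u. X u \<omega> = X s \<omega>) (at_right s)" if "\<omega> \<in> space M" "0 \<le> s" for \<omega> s
    using mc that by (simp add: markov_chain_def cadlag_path_def)
  have R_lim: "(\<lambda>n. R n \<omega>) \<longlonglongrightarrow> I \<omega>" if "\<omega> \<in> space M" for \<omega>
    unfolding R_def I_def \<delta>_def by (rule riemann_sum_right_continuous(2)[where x = "\<lambda>s. X s \<omega>" and B = B]) (use path that B t in auto)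
  have R_meas: "R n \<in> borel_measurable M" for n
  proof -
    have "(\<lambda>\<omega>. f (X (real k * \<delta> n) \<omega>)) \<in> borel_measurable M" for k
      by (rule measurable_compose[OF X]) (use d(1)[of n] in auto)
    then show ?thesis
      unfolding R_def[abs_def] by (intro borel_measurable_times borel_measurable_sum) auto
  qed
  have I_meas: "I \<in> borel_measurable M"
    by (rule borel_measurable_LIMSEQ_real[OF R_lim R_meas])
  have R_bound: "\<bar>R n \<omega>\<bar> \<le> 2 * t * B" for n \<omega>
  proof -
    have "\<bar>\<Sum>k<Suc (Suc n). f (X (real k * \<delta> n) \<omega>)\<bar> \<le> (\<Sum>k<Suc (Suc n). B)"
      by (rule order_trans[OF sum_abs]) (intro sum_mono B)
    then have "\<bar>R n \<omega>\<bar> \<le> \<delta> n * (real (Suc (Suc n)) * B)"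
      using d(1)[of n] by (simp add: R_def abs_mult del: sum.lessThan_Suc)
    also have "\<delta> n * (real (Suc (Suc n)) * B) \<le> 2 * t * B"
    proof -
      have "\<delta> n * real (Suc (Suc n)) \<le> 2 * t"
        using t by (simp add: \<delta>_def field_simps)
      moreover have "0 \<le> B" by (simp add: B_def)
      ultimately have "\<delta> n * real (Suc (Suc n)) * B \<le> 2 * t * B"
        by (rule mult_right_mono)
      then show ?thesis by (simp only: mult.assoc)
    qed
    finally show ?thesis .
  qed
  have R_exp_bound: "exp (\<theta> * R n \<omega>) \<le> exp (\<theta> * (2 * t * B))" for n \<omega>
    using R_bound[of n \<omega>] theta by simp
  have lim: "(\<lambda>n. expectation (\<lambda>\<omega>. exp (\<theta> * R n \<omega>))) \<longlonglongrightarrow> expectation (\<lambda>\<omega>. exp (\<theta> * I \<omega>))"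
    and I_int: "integrable M (\<lambda>\<omega>. exp (\<theta> * I \<omega>))"
  proof -
    have 1: "AE \<omega> in M. (\<lambda>n. exp (\<theta> * R n \<omega>)) \<longlonglongrightarrow> exp (\<theta> * I \<omega>)"
      by (intro AE_I2 tendsto_intros R_lim)
    have 2: "AE \<omega> in M. norm (exp (\<theta> * R n \<omega>)) \<le> exp (\<theta> * (2 * t * B))" for n
      using R_exp_bound by simp
    have 3: "integrable M (\<lambda>\<omega>. exp (\<theta> * (2 * t * B)))"
      by simp
    have 4: "(\<lambda>\<omega>. exp (\<theta> * I \<omega>)) \<in> borel_measurable M"
      using I_meas by measurable
    have 5: "(\<lambda>\<omega>. exp (\<theta> * R n \<omega>)) \<in> borel_measurable M" for n
      using R_meas[of n] by measurable
    show "(\<lambda>n. expectation (\<lambda>\<omega>. exp (\<theta> * R n \<omega>))) \<longlonglongrightarrow> expectation (\<lambda>\<omega>. exp (\<theta> * I \<omega>))"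
      by (rule integral_dominated_convergence[OF 4 5 3 1 2])
    show "integrable M (\<lambda>\<omega>. exp (\<theta> * I \<omega>))"
      by (rule integrable_dominated_convergence[OF 4 5 3 1 2])
  qed
  have R_le: "expectation (\<lambda>\<omega>. exp (\<theta> * R n \<omega>))
      \<le> exp (t * L + \<delta> n * (4 * t * \<theta>\<^sup>2 * (b - a)\<^sup>2 + \<theta> * (b - E g)))"
    if small: "2 * \<delta> n * \<theta> * (b - a) \<le> 1 / 2" for n
  proof -
    let ?F = "tilted_iter (\<delta> n) (\<lambda>i. exp (\<delta> n * \<theta> * f i)) (Suc n)"
    have "(\<integral>\<^sup>+\<omega>. ennreal (exp (\<theta> * R n \<omega>)) \<partial>M) = ennreal (E ?F)"
      unfolding R_def by (rule nn_integral_exp_sum[OF mc d(1) f(2)]) (use theta in simp)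
    moreover have "(\<integral>\<^sup>+\<omega>. ennreal (exp (\<theta> * R n \<omega>)) \<partial>M) = ennreal (expectation (\<lambda>\<omega>. exp (\<theta> * R n \<omega>)))"
      using R_meas R_exp_bound
      by (intro nn_integral_eq_integral integrable_const_bound[where B = "exp (\<theta> * (2 * t * B))"]) auto
    moreover have "0 \<le> E ?F"
      by (intro integral_nonneg_AE AE_I2 tilted_iter_nonneg) simp
    ultimately have "expectation (\<lambda>\<omega>. exp (\<theta> * R n \<omega>)) = E ?F"
      by (simp add: integral_nonneg_AE)
    also have "\<dots> \<le> exp (real (Suc n) * \<delta> n * (\<theta>\<^sup>2 * (b - E g - (a - E g))\<^sup>2 / (4 * \<gamma>))
        + \<delta> n * (4 * (real (Suc n) * \<delta> n) * \<theta>\<^sup>2 * (b - E g - (a - E g))\<^sup>2 + \<theta> * (b - E g)))"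
      using theta small by (intro E_tilted_iter_le[OF gap gamma mean f]) (auto simp: d)
    also have "\<dots> = exp (t * L + \<delta> n * (4 * t * \<theta>\<^sup>2 * (b - a)\<^sup>2 + \<theta> * (b - E g)))"
      unfolding d(2) L_def by simp
    finally show ?thesis .
  qed
  have "(\<lambda>n. exp (t * L + \<delta> n * (4 * t * \<theta>\<^sup>2 * (b - a)\<^sup>2 + \<theta> * (b - E g))))
      \<longlonglongrightarrow> exp (t * L + 0 * (4 * t * \<theta>\<^sup>2 * (b - a)\<^sup>2 + \<theta> * (b - E g)))"
    by (intro tendsto_intros dlim)
  moreover have "\<forall>\<^sub>F n in sequentially. expectation (\<lambda>\<omega>. exp (\<theta> * R n \<omega>))
      \<le> exp (t * L + \<delta> n * (4 * t * \<theta>\<^sup>2 * (b - a)\<^sup>2 + \<theta> * (b - E g)))"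
  proof -
    have "(\<lambda>n. 2 * \<delta> n * \<theta> * (b - a)) \<longlonglongrightarrow> 2 * 0 * \<theta> * (b - a)"
      by (intro tendsto_intros dlim)
    then have "\<forall>\<^sub>F n in sequentially. 2 * \<delta> n * \<theta> * (b - a) < 1 / 2"
      by (intro order_tendstoD(2)) auto
    then show ?thesis
      by eventually_elim (rule R_le, simp)
  qed
  ultimately have mgf: "expectation (\<lambda>\<omega>. exp (\<theta> * I \<omega>)) \<le> exp (t * L)"
    using tendsto_le[OF trivial_limit_sequentially _ lim] by simp
  have "(1 / t) * (LBINT s:{0..t}. g (X s \<omega>)) - E g \<ge> \<epsilon> \<longleftrightarrow> I \<omega> \<ge> t * \<epsilon>" if "\<omega> \<in> space M" for \<omega>
  proof -
    have "set_integrable lborel {0..t} (\<lambda>s. g (X s \<omega>))"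
      by (rule riemann_sum_right_continuous(1)[where x = "\<lambda>s. X s \<omega>" and B = "\<bar>a\<bar> + \<bar>b\<bar>"])
        (use path that t gB in auto)
    moreover have "set_integrable lborel {0..t} (\<lambda>s. E g)"
      using t by (simp add: set_integrable_def integrable_indicator_iff)
    ultimately have I_eq: "I \<omega> = (LBINT s:{0..t}. g (X s \<omega>)) - t * E g"
      using t unfolding I_def f_def by (subst set_integral_diff(2)) (auto simp: set_integral_const)
    have "(1 / t) * (LBINT s:{0..t}. g (X s \<omega>)) - E g = I \<omega> / t"
      using t by (simp add: I_eq diff_divide_distrib)
    then show ?thesis
      using t by (simp add: pos_le_divide_eq mult.commute)
  qed
  then have "measure M {\<omega> \<in> space M. (1 / t) * (LBINT s:{0..t}. g (X s \<omega>)) - E g \<ge> \<epsilon>}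
      = measure M {\<omega> \<in> space M. I \<omega> \<ge> t * \<epsilon>}"
    by (intro arg_cong[where f = "measure M"] Collect_cong) blast
  also have "\<dots> \<le> exp (- \<theta> * (t * \<epsilon>)) * (\<integral>\<omega>\<in>space M. exp (\<theta> * I \<omega>) \<partial>M)"
  proof (rule Chernoff_ineq_ge[OF theta])
    show "set_integrable M (space M) (\<lambda>\<omega>. exp (\<theta> * I \<omega>))"
      unfolding set_integrable_def by (rule integrable_mult_indicator[OF sets.top I_int])
  qed simp
  also have "(\<integral>\<omega>\<in>space M. exp (\<theta> * I \<omega>) \<partial>M) = expectation (\<lambda>\<omega>. exp (\<theta> * I \<omega>))"
    by (rule set_integral_space[OF I_int])
  also have "exp (- \<theta> * (t * \<epsilon>)) * \<dots> \<le> exp (- \<theta> * (t * \<epsilon>)) * exp (t * L)"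
    using mgf by (rule mult_left_mono) simp
  also have "\<dots> = exp (- (\<gamma> * t * \<epsilon>\<^sup>2 / (b - a)\<^sup>2))"
  proof -
    define v where "v = (b - a)\<^sup>2"
    have v: "v \<noteq> 0"
      using D by (simp add: v_def)
    have "(2 * \<gamma> * \<epsilon> / v)\<^sup>2 * v / (4 * \<gamma>) = \<gamma> * \<epsilon>\<^sup>2 / v"
      using v gamma by (simp add: power2_eq_square)
    then have L_eq: "L = \<gamma> * \<epsilon>\<^sup>2 / v"
      by (simp add: L_def \<theta>_def v_def)
    have "- \<theta> * (t * \<epsilon>) + t * L = - (\<gamma> * t * \<epsilon>\<^sup>2 / v)"
      unfolding L_eq \<theta>_def v_def[symmetric] by (simp add: power2_eq_square)
    then show ?thesis
      unfolding exp_add[symmetric] v_def by simp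
  qed
  finally show ?thesis .
qed

end

theorem theorem2p1:
  fixes Q :: "'e :: countable \<Rightarrow> 'e \<Rightarrow> real"
    and P :: "real \<Rightarrow> 'e \<Rightarrow> 'e pmf"
    and PP :: "'e pmf \<Rightarrow> 'w measure"
    and X :: "real \<Rightarrow> 'w \<Rightarrow> 'e"
    and \<pi> :: "'e pmf"
    and g :: "'e \<Rightarrow> real"
    and a b t \<epsilon> :: real
  assumes "regular_q Q"
    and "q_transition Q P"
    and "\<And>\<mu>. markov_chain (PP \<mu>) X \<mu> P"
    and "irreducible_chain P"
    and "positive_recurrent Q PP X"
    and "invariant_distr P \<pi>"
    and "\<And>\<nu>. invariant_distr P \<nu> \<Longrightarrow> \<nu> = \<pi>"
    and "0 < spectral_gap \<pi> P"
    and "regular_q (symmetrized_q \<pi> Q)"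
    and "a < b"
    and "range g \<subseteq> {a..b}"
    and "0 < t"
    and "0 < \<epsilon>"
  shows "ereal (measure (PP \<pi>) {\<omega> \<in> space (PP \<pi>).
             (1 / t) * (LBINT s:{0..t}. g (X s \<omega>)) - measure_pmf.expectation \<pi> g \<ge> \<epsilon>})
         \<le> ereal_exp (- (spectral_gap \<pi> P * ereal t * ereal (\<epsilon>\<^sup>2) / ereal ((b - a)\<^sup>2)))"
proof -
  interpret stationary_semigroup P \<pi>
    using assms(2,4,6) by (rule stationary_semigroup_q_process)
  define p where "p = measure (PP \<pi>) {\<omega> \<in> space (PP \<pi>).
    (1 / t) * (LBINT s:{0..t}. g (X s \<omega>)) - measure_pmf.expectation \<pi> g \<ge> \<epsilon>}"
  define c where "c = t * \<epsilon>\<^sup>2 / (b - a)\<^sup>2"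
  have c: "0 < c"
    using assms(10,12,13) by (simp add: c_def)
  have g: "a \<le> g i" "g i \<le> b" for i
    using subsetD[OF assms(11) rangeI, of i] by auto
  have bound: "p \<le> exp (- (\<gamma> * c))" if "ereal \<gamma> \<le> spectral_gap \<pi> P" "0 < \<gamma>" for \<gamma>
    using hoeffding_time_integral[OF assms(3)[of \<pi>] that assms(10) g assms(12,13)]
    by (simp add: p_def c_def mult.assoc)
  show ?thesis
  proof (cases "spectral_gap \<pi> P")
    case (real \<gamma>)
    then have "0 < \<gamma>"
      using assms(8) by simp
    moreover have "spectral_gap \<pi> P * ereal t * ereal (\<epsilon>\<^sup>2) / ereal ((b - a)\<^sup>2) = ereal (\<gamma> * c)"
      using assms(10) by (simp add: real c_def mult.assoc)
    ultimately show ?thesis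
      using bound[of \<gamma>] unfolding p_def[symmetric] by (simp add: ereal_exp_def real)
  next
    case PInf
    have pow_lim: "(\<lambda>n. exp (- c) ^ Suc n) \<longlonglongrightarrow> 0"
      using c by (intro LIMSEQ_Suc LIMSEQ_power_zero) simp
    have pow_bound: "p \<le> exp (- c) ^ Suc n" for n
    proof -
      have "p \<le> exp (- (real (Suc n) * c))"
        by (rule bound) (simp_all add: PInf)
      then show ?thesis
        unfolding exp_of_nat_mult[symmetric] by (simp only: mult_minus_right)
    qed
    have "p \<le> 0"
      by (rule LIMSEQ_le_const[OF pow_lim]) (use pow_bound in blast)
    moreover have "- (spectral_gap \<pi> P * ereal t * ereal (\<epsilon>\<^sup>2) / ereal ((b - a)\<^sup>2)) = - \<infinity>"
      using assms(10,12,13) by (simp add: PInf)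
    ultimately show ?thesis
      unfolding p_def[symmetric] by (simp add: ereal_exp_def)
  next
    case MInf
    then show ?thesis
      using assms(8) by simp
  qed
qed

end
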